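(* Let $T$ be a standard type theory. (1) If $\Theta;\Gamma\vdash_T t:A$ and $\Theta;\Gamma\vdash_T t:B$, then $\Theta;\Gamma\vdash_T A\equiv B$. (2) If $\vdash_T\Theta\ \mathsf{mctx}$, $\Theta\vdash_T\Gamma\ \mathsf{vctx}$, $\Theta;\Gamma\vdash_T s\equiv t:A$ and $\Theta;\Gamma\vdash_T s\equiv t:B$, then $\Theta;\Gamma\vdash_T A\equiv B$.
   Context: Standard theories: given a raw rule-boundary $\Xi\Longrightarrow\beta$ (a metavariable context $\Xi=[M_1{:}\mathcal B_1,\dots,M_n{:}\mathcal B_n]$ and a closed boundary thesis $\beta$ over it) with $\beta$ a type or term boundary of class $c$, and a symbol $S$ with arity $(c,[\mathrm{ar}(\mathcal B_1),\dots,\mathrm{ar}(\mathcal B_n)])$, the associated symbol rule is $\Xi\Longrightarrow\beta[S(\hat M_1,\dots,\hat M_n)]$, where $\hat M_i=\{x_1\}\cdots\{x_k\}M_i(x_1,\dots,x_k)$ if $\mathrm{ar}(\mathcal B_i)=(c',k)$ with $c'\in\{\mathrm{Ty},\mathrm{Tm}\}$, and $\hat M_i=\{x_1\}\cdots\{x_k\}\star$ otherwise. A raw rule $\Xi\Longrightarrow\beta[e]$ is finitary over a raw theory $T'$ if $\vdash_{T'}\Xi\ \mathsf{mctx}$ and $\Xi;[]\vdash_{T'}\beta$; a raw theory $(R_i)_{i\in I}$ is finitary if there is a well-founded order $\prec$ on $I$ with each $R_i$ finitary over $(R_j)_{j\prec i}$. A finitary theory is standard if each of its specific object rules is a symbol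 rule and each symbol has precisely one associated rule. Well-formed contexts: $\vdash_T[]\ \mathsf{mctx}$; $\vdash_T[\Theta,M{:}\mathcal B]\ \mathsf{mctx}$ if $\vdash_T\Theta\ \mathsf{mctx}$, $\Theta;[]\vdash_T\mathcal B$ and $M\notin|\Theta|$; $\Theta\vdash_T[]\ \mathsf{vctx}$; $\Theta\vdash_T(\Gamma,a{:}A)\ \mathsf{vctx}$ if $\Theta\vdash_T\Gamma\ \mathsf{vctx}$, $\Theta;\Gamma\vdash_T A\ \mathsf{type}$, $a\notin|\Gamma|$. Raw syntax. A signature $\Sigma$ assigns to each symbol $S$ an arity $(c,[(c_1,n_1),\dots,(c_k,n_k)])$ with $c\in\{\mathrm{Ty},\mathrm{Tm}\}$ (the class of $S$) and $c_i\in\{\mathrm{Ty},\mathrm{Tm},\mathrm{EqTy},\mathrm{EqTm}\}$: the $i$-th argument has class $c_i$ and binds $n_i$ variables. There are disjoint supplies of free variables $a,b,\dots$, bound variables $x,y,\dots$ and metavariables $M,N,\dots$. Type expressions are $S(e_1,\dots,e_k)$ ($S$ of class Ty) or $M(t_1,\dots,t_n)$ ($M$ of arity $(\mathrm{Ty},n)$); term expressions are $a$, $x$, $S(e_1,\dots,e_k)$ ($S$ of class Tm) or $M(t_1,\dots,t_n)$ ($M$ of arity $(\mathrm{Tm},n)$); arguments are type or term expressions, a dummy $\star$ (of class EqTy or EqTm), or abstractions $\{x\}e$ binding $x$ in $e$; the $i$-th argument of $S$ must have the form $\{x_1\}\cdots\{x_{n_i}\}e'$ with $e'$ of class $c_i$.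 Expressions are identified up to renaming of bound variables; $e[\vec s/\vec x]$ is simultaneous capture-avoiding substitution, $e[a/x]$ replacement of a bound variable by a free one. Judgement theses: $A\ \mathsf{type}$, $t:A$, $A\equiv B$, $s\equiv t:A$; abstracted judgements $\mathcal J::=\text{thesis}\mid\{x{:}A\}\mathcal J$. Boundary theses: $\Box\ \mathsf{type}$, $\Box:A$, $A\equiv B\ \mathsf{by}\ \Box$, $s\equiv t:A\ \mathsf{by}\ \Box$; abstracted boundaries $\mathcal B::=\text{thesis}\mid\{x{:}A\}\mathcal B$. A metavariable context is a list $\Theta=[M_1{:}\mathcal B_1,\dots,M_n{:}\mathcal B_n]$ of distinct metavariables with closed boundaries, $\mathcal B_i$ mentioning only $M_1,\dots,M_{i-1}$; $M_i$ receives arity $\mathrm{ar}(\mathcal B_i)=(c,m)$ if $\mathcal B_i=\{x_1{:}A_1\}\cdots\{x_m{:}A_m\}\beta$ with $\beta$ of class $c$ (Ty, Tm, EqTy, EqTm for the four boundary forms). A variable context $\Gamma=[a_1{:}A_1,\dots,a_n{:}A_n]$ consists of distinct free variables with $A_i$ mentioning only $a_1,\dots,a_{i-1}$; $|\Gamma|$ is its domain and $\Gamma(a_i)=A_i$. Filling a boundary with a head: $(\Box\ \mathsf{type})[A]=(A\ \mathsf{type})$, $(\Box:A)[t]=(t:A)$, equality boundaries filled with $\star$ give the equation, $(\{x{:}A\}\mathcal B)[\{x\}e]=\{x{:}A\}(\mathcal B[e])$; filling a type/term boundary with an equation: $(\Box\ \mathsf{type})[A_1\equiv A_2]=(A_1\equiv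 A_2)$, $(\Box:A)[t_1\equiv t_2]=(t_1\equiv t_2:A)$, commuting with abstraction. Instantiation $I=\langle M_1\mapsto e_1,\dots,M_n\mapsto e_n\rangle$ of $\Xi$ (arguments of matching arities): $I_*(M_i(t_1,\dots,t_m))=e_i'[I_*t_1/x_1,\dots,I_*t_m/x_m]$ where $e_i=\{x_1\}\cdots\{x_m\}e_i'$, homomorphic elsewhere; $I_{(i)}$ is the restriction to $M_1,\dots,M_{i-1}$. Raw rules: $\Xi\Longrightarrow\mathcal J$ with $\mathcal J$ closed non-abstracted over $\Xi$; object rule if $\mathcal J$ is a type/term judgement. A raw type theory $T$ is a family of raw rules. Derivability $\vdash_T$ is membership in the least set closed under, for all $\Theta,\Gamma$: (variable) $\Theta;\Gamma\vdash a:\Gamma(a)$ for $a\in|\Gamma|$; (metavariable) if $\Theta(M)=\{x_1{:}A_1\}\cdots\{x_m{:}A_m\}\beta$, from $\Theta;\Gamma\vdash t_j:A_j[t_1,\dots,t_{j-1}/x_1,\dots,x_{j-1}]$ and $\Theta;\Gamma\vdash\beta[\vec t/\vec x]$ infer $\Theta;\Gamma\vdash(\beta[\vec t/\vec x])[M(\vec t)]$; (metavariable congruence) for object $\beta$, from $\Theta;\Gamma\vdash s_j:A_j[\vec s_{<j}/\vec x_{<j}]$, $\Theta;\Gamma\vdash t_j:A_j[\vec t_{<j}/\vec x_{<j}]$, $\Theta;\Gamma\vdash s_j\equiv t_j:A_j[\vec s_{<j}/\vec x_{<j}]$ and, if $\beta=(\Box:C)$, $\Theta;\Gamma\vdash C[\vec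 s/\vec x]\equiv C[\vec t/\vec x]$, infer $\Theta;\Gamma\vdash(\beta[\vec s/\vec x])[M(\vec s)\equiv M(\vec t)]$; (abstraction) from $\Theta;\Gamma\vdash A\ \mathsf{type}$ and $\Theta;\Gamma,a{:}A\vdash\mathcal J[a/x]$ with $a\notin|\Gamma|$ infer $\Theta;\Gamma\vdash\{x{:}A\}\mathcal J$; reflexivity, symmetry, transitivity of type and term equality; conversion: from $t:A$ and $A\equiv B$ infer $t:B$, from $s\equiv t:A$ and $A\equiv B$ infer $s\equiv t:B$; boundary rules: $\Box\ \mathsf{type}$; $\Box:A$ from $A\ \mathsf{type}$; $A\equiv B\ \mathsf{by}\ \Box$ from $A\ \mathsf{type},B\ \mathsf{type}$; $s\equiv t:A\ \mathsf{by}\ \Box$ from $A\ \mathsf{type},s:A,t:A$; $\{x{:}A\}\mathcal B$ from $A\ \mathsf{type}$ and $\Theta;\Gamma,a{:}A\vdash\mathcal B[a/x]$, $a\notin|\Gamma|$; (specific rules) for a specific rule $[M_1{:}\mathcal B_1,\dots,M_n{:}\mathcal B_n]\Longrightarrow\beta[e]$ and $I=\langle M_i\mapsto e_i\rangle$ over $\Theta;\Gamma$: from $\Theta;\Gamma\vdash(I_{(i)*}\mathcal B_i)[e_i]$ for all $i$ and $\Theta;\Gamma\vdash I_*\beta$ infer $\Theta;\Gamma\vdash I_*(\beta[e])$; (congruence) for a specific object rule and $I=\langle M_i\mapsto f_i\rangle$, $J=\langle M_i\mapsto g_i\rangle$: from $\Theta;\Gamma\vdash(I_{(i)*}\mathcal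 B_i)[f_i]$, $\Theta;\Gamma\vdash(J_{(i)*}\mathcal B_i)[g_i]$ for all $i$, $\Theta;\Gamma\vdash(I_{(i)*}\mathcal B_i)[f_i\equiv g_i]$ for object $\mathcal B_i$, and $\Theta;\Gamma\vdash I_*B\equiv J_*B$ if $\beta=(\Box:B)$, infer $\Theta;\Gamma\vdash(I_*\beta)[I_*e\equiv J_*e]$.
   Formalization: In (1), when t is a free variable and A, B are the same expression, Γ is additionally assumed to be a well-formed variable context; without this (1) fails, since a variable of an ill-formed Γ may have a type A that is not derivably a type, so A ≡ A is not derivable. *)

theory Defs
  imports Main
begin

section \<open>Raw syntax\<close>

datatype cls = Ty | Tm | EqTy | EqTm

definition object_cls :: "cls \<Rightarrow> bool" where
  "object_cls c \<longleftrightarrow> c \<in> {Ty, Tm}"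

text \<open>The arity of an argument or of a metavariable: its class and the number of variables it binds.\<close>

type_synonym arity = "cls \<times> nat"

type_synonym 's signature = "'s \<rightharpoonup> cls \<times> arity list"

definition signature :: "'s signature \<Rightarrow> bool" where
  "signature \<Sigma> \<longleftrightarrow> (\<forall>S c ars. \<Sigma> S = Some (c, ars) \<longrightarrow> object_cls c)"

type_synonym fvar = nat
type_synonym mvar = nat

text \<open>
  Bound variables are de Bruijn indices, so that expressions equal up to renaming of bound
  variables are equal. Expressions and arguments share one datatype; classes and arities are
  enforced by the predicate \<open>raw_arg\<close> below.
\<close>

datatype 's expr =
    FVar fvar
  | BVar nat
  | Sym 's "'s expr list"
  | Meta mvar "'s expr list"
  | Star
  | Abs "'s expr"

datatype 'e jthesis =
    IsType 'e
  | HasType 'e 'e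
  | TypeEq 'e 'e
  | TermEq 'e 'e 'e  \<comment> \<open>\<open>TermEq s t A\<close> is \<open>s \<equiv> t : A\<close>\<close>

datatype 'e judgement = JThesis "'e jthesis" | JAbs 'e "'e judgement"

datatype 'e bthesis =
    TypeB
  | TermB 'e
  | TypeEqB 'e 'e
  | TermEqB 'e 'e 'e  \<comment> \<open>\<open>TermEqB s t A\<close> is \<open>s \<equiv> t : A by \<box>\<close>\<close>

datatype 'e boundary = BThesis "'e bthesis" | BAbs 'e "'e boundary"

abbreviation babs :: "'e list \<Rightarrow> 'e bthesis \<Rightarrow> 'e boundary" where
  "babs As \<beta> \<equiv> foldr BAbs As (BThesis \<beta>)"

primrec bclass :: "'e bthesis \<Rightarrow> cls" where
  "bclass TypeB = Ty"
| "bclass (TermB A) = Tm"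
| "bclass (TypeEqB A B) = EqTy"
| "bclass (TermEqB s t A) = EqTm"

primrec ar :: "'e boundary \<Rightarrow> arity" where
  "ar (BThesis \<beta>) = (bclass \<beta>, 0)"
| "ar (BAbs A B) = (fst (ar B), Suc (snd (ar B)))"

definition object_bdry :: "'e boundary \<Rightarrow> bool" where
  "object_bdry B \<longleftrightarrow> object_cls (fst (ar B))"

type_synonym 's mctx = "(mvar \<times> 's expr boundary) list"
type_synonym 's vctx = "(fvar \<times> 's expr) list"

definition cdom :: "('k \<times> 'v) list \<Rightarrow> 'k set" where
  "cdom \<Delta> = fst ` set \<Delta>"

definition mvar_ar :: "'s mctx \<Rightarrow> mvar \<rightharpoonup> arity" where
  "mvar_ar \<Theta> M = map_option ar (map_of \<Theta> M)"

text \<open>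
  \<open>raw_arg \<Sigma> D V k (c, n) e\<close>: over the signature \<open>\<Sigma>\<close>, metavariables of arities \<open>D\<close>, free variables
  \<open>V\<close> and \<open>k\<close> bound variables in scope, \<open>e\<close> is an \<open>n\<close>-fold abstraction of an expression of class
  \<open>c\<close>. Type and term expressions are the arguments of arity \<open>(Ty, 0)\<close> and \<open>(Tm, 0)\<close>.
\<close>

inductive raw_arg ::
    "'s signature \<Rightarrow> (mvar \<rightharpoonup> arity) \<Rightarrow> fvar set \<Rightarrow> nat \<Rightarrow> arity \<Rightarrow> 's expr \<Rightarrow> bool"
  for \<Sigma> D V where
  raw_FVar: "a \<in> V \<Longrightarrow> raw_arg \<Sigma> D V k (Tm, 0) (FVar a)"
| raw_BVar: "i < k \<Longrightarrow> raw_arg \<Sigma> D V k (Tm, 0) (BVar i)"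
| raw_Sym: "\<Sigma> S = Some (c, ars) \<Longrightarrow> object_cls c \<Longrightarrow> list_all2 (raw_arg \<Sigma> D V k) ars es
    \<Longrightarrow> raw_arg \<Sigma> D V k (c, 0) (Sym S es)"
| raw_Meta: "D M = Some (c, length ts) \<Longrightarrow> object_cls c
    \<Longrightarrow> list_all (raw_arg \<Sigma> D V k (Tm, 0)) ts
    \<Longrightarrow> raw_arg \<Sigma> D V k (c, 0) (Meta M ts)"
| raw_Star: "\<not> object_cls c \<Longrightarrow> raw_arg \<Sigma> D V k (c, 0) Star"
| raw_Abs: "raw_arg \<Sigma> D V (Suc k) (c, n) e \<Longrightarrow> raw_arg \<Sigma> D V k (c, Suc n) (Abs e)"

context
  fixes \<Sigma> :: "'s signature" and D :: "mvar \<rightharpoonup> arity" and V :: "fvar set"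
begin

abbreviation raw_type :: "nat \<Rightarrow> 's expr \<Rightarrow> bool" where
  "raw_type k \<equiv> raw_arg \<Sigma> D V k (Ty, 0)"

abbreviation raw_term :: "nat \<Rightarrow> 's expr \<Rightarrow> bool" where
  "raw_term k \<equiv> raw_arg \<Sigma> D V k (Tm, 0)"

primrec raw_jthesis :: "nat \<Rightarrow> 's expr jthesis \<Rightarrow> bool" where
  "raw_jthesis k (IsType A) \<longleftrightarrow> raw_type k A"
| "raw_jthesis k (HasType t A) \<longleftrightarrow> raw_term k t \<and> raw_type k A"
| "raw_jthesis k (TypeEq A B) \<longleftrightarrow> raw_type k A \<and> raw_type k B"
| "raw_jthesis k (TermEq s t A) \<longleftrightarrow> raw_term k s \<and> raw_term k t \<and> raw_type k A"

primrec raw_judgement :: "nat \<Rightarrow> 's expr judgement \<Rightarrow> bool" where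
  "raw_judgement k (JThesis j) \<longleftrightarrow> raw_jthesis k j"
| "raw_judgement k (JAbs A J) \<longleftrightarrow> raw_type k A \<and> raw_judgement (Suc k) J"

primrec raw_bthesis :: "nat \<Rightarrow> 's expr bthesis \<Rightarrow> bool" where
  "raw_bthesis k TypeB \<longleftrightarrow> True"
| "raw_bthesis k (TermB A) \<longleftrightarrow> raw_type k A"
| "raw_bthesis k (TypeEqB A B) \<longleftrightarrow> raw_type k A \<and> raw_type k B"
| "raw_bthesis k (TermEqB s t A) \<longleftrightarrow> raw_term k s \<and> raw_term k t \<and> raw_type k A"

primrec raw_boundary :: "nat \<Rightarrow> 's expr boundary \<Rightarrow> bool" where
  "raw_boundary k (BThesis \<beta>) \<longleftrightarrow> raw_bthesis k \<beta>"
| "raw_boundary k (BAbs A B) \<longleftrightarrow> raw_type k A \<and> raw_boundary (Suc k) B"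

end

definition raw_mctx :: "'s signature \<Rightarrow> 's mctx \<Rightarrow> bool" where
  "raw_mctx \<Sigma> \<Theta> \<longleftrightarrow> distinct (map fst \<Theta>) \<and>
    (\<forall>i<length \<Theta>. raw_boundary \<Sigma> (mvar_ar (take i \<Theta>)) {} 0 (snd (\<Theta> ! i)))"

definition raw_vctx :: "'s signature \<Rightarrow> 's mctx \<Rightarrow> 's vctx \<Rightarrow> bool" where
  "raw_vctx \<Sigma> \<Theta> \<Gamma> \<longleftrightarrow> distinct (map fst \<Gamma>) \<and>
    (\<forall>i<length \<Gamma>. raw_type \<Sigma> (mvar_ar \<Theta>) (cdom (take i \<Gamma>)) 0 (snd (\<Gamma> ! i)))"

definition raw_ctxs :: "'s signature \<Rightarrow> 's mctx \<Rightarrow> 's vctx \<Rightarrow> bool" where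
  "raw_ctxs \<Sigma> \<Theta> \<Gamma> \<longleftrightarrow> raw_mctx \<Sigma> \<Theta> \<and> raw_vctx \<Sigma> \<Theta> \<Gamma>"


section \<open>Substitution, filling and instantiation\<close>

primrec shift :: "nat \<Rightarrow> 's expr \<Rightarrow> 's expr" where
  "shift k (FVar a) = FVar a"
| "shift k (BVar i) = BVar (if i < k then i else Suc i)"
| "shift k (Sym S es) = Sym S (map (shift k) es)"
| "shift k (Meta M ts) = Meta M (map (shift k) ts)"
| "shift k Star = Star"
| "shift k (Abs e) = Abs (shift (Suc k) e)"

definition up :: "(nat \<Rightarrow> 's expr) \<Rightarrow> nat \<Rightarrow> 's expr" where
  "up \<sigma> = case_nat (BVar 0) (\<lambda>i. shift 0 (\<sigma> i))"

primrec esubst :: "(nat \<Rightarrow> 's expr) \<Rightarrow> 's expr \<Rightarrow> 's expr" where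
  "esubst \<sigma> (FVar a) = FVar a"
| "esubst \<sigma> (BVar i) = \<sigma> i"
| "esubst \<sigma> (Sym S es) = Sym S (map (esubst \<sigma>) es)"
| "esubst \<sigma> (Meta M ts) = Meta M (map (esubst \<sigma>) ts)"
| "esubst \<sigma> Star = Star"
| "esubst \<sigma> (Abs e) = Abs (esubst (up \<sigma>) e)"

primrec jsubst :: "(nat \<Rightarrow> 's expr) \<Rightarrow> 's expr judgement \<Rightarrow> 's expr judgement" where
  "jsubst \<sigma> (JThesis j) = JThesis (map_jthesis (esubst \<sigma>) j)"
| "jsubst \<sigma> (JAbs A J) = JAbs (esubst \<sigma> A) (jsubst (up \<sigma>) J)"

primrec bsubst :: "(nat \<Rightarrow> 's expr) \<Rightarrow> 's expr boundary \<Rightarrow> 's expr boundary" where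
  "bsubst \<sigma> (BThesis \<beta>) = BThesis (map_bthesis (esubst \<sigma>) \<beta>)"
| "bsubst \<sigma> (BAbs A B) = BAbs (esubst \<sigma> A) (bsubst (up \<sigma>) B)"

text \<open>
  \<open>vec [t\<^sub>1, \<dots>, t\<^sub>m]\<close> substitutes \<open>t\<^sub>1, \<dots>, t\<^sub>m\<close> for the \<open>m\<close> innermost bound variables
  \<open>x\<^sub>1, \<dots>, x\<^sub>m\<close>, of which \<open>x\<^sub>m\<close> has index 0 and \<open>x\<^sub>1\<close> has index \<open>m - 1\<close>.
\<close>

definition vec :: "'s expr list \<Rightarrow> nat \<Rightarrow> 's expr" where
  "vec ts i = (if i < length ts then ts ! (length ts - Suc i) else BVar (i - length ts))"

text \<open>
  The head of an equality judgement carries no information (it is \<open>\<star>\<close>, or an application of an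
  equality metavariable, which stands for \<open>\<star>\<close>), so filling an equality boundary ignores it.
\<close>

primrec fill :: "'e bthesis \<Rightarrow> 'e \<Rightarrow> 'e jthesis" where
  "fill TypeB e = IsType e"
| "fill (TermB A) e = HasType e A"
| "fill (TypeEqB A B) e = TypeEq A B"
| "fill (TermEqB s t A) e = TermEq s t A"

fun bfill :: "'s expr boundary \<Rightarrow> 's expr \<Rightarrow> 's expr judgement" where
  "bfill (BThesis \<beta>) e = JThesis (fill \<beta> e)"
| "bfill (BAbs A B) (Abs e) = JAbs A (bfill B e)"

fun fill_eq :: "'e bthesis \<Rightarrow> 'e \<Rightarrow> 'e \<Rightarrow> 'e jthesis" where
  "fill_eq TypeB e\<^sub>1 e\<^sub>2 = TypeEq e\<^sub>1 e\<^sub>2"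
| "fill_eq (TermB A) e\<^sub>1 e\<^sub>2 = TermEq e\<^sub>1 e\<^sub>2 A"

fun bfill_eq :: "'s expr boundary \<Rightarrow> 's expr \<Rightarrow> 's expr \<Rightarrow> 's expr judgement" where
  "bfill_eq (BThesis \<beta>) e\<^sub>1 e\<^sub>2 = JThesis (fill_eq \<beta> e\<^sub>1 e\<^sub>2)"
| "bfill_eq (BAbs A B) (Abs e\<^sub>1) (Abs e\<^sub>2) = JAbs A (bfill_eq B e\<^sub>1 e\<^sub>2)"

fun unabs :: "nat \<Rightarrow> 's expr \<Rightarrow> 's expr" where
  "unabs 0 e = e"
| "unabs (Suc n) (Abs e) = unabs n e"

type_synonym 's minst = "(mvar \<times> 's expr) list"

text \<open>
  \<open>raw_inst \<Sigma> \<Theta> \<Gamma> \<Xi> I\<close>: \<open>I\<close> is an instantiation of \<open>\<Xi>\<close> over \<open>\<Theta>; \<Gamma>\<close>. Its arguments have no loose bound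
  variables, hence \<open>inst\<close> may pass under \<open>Abs\<close> without shifting them.
\<close>

definition raw_inst ::
    "'s signature \<Rightarrow> 's mctx \<Rightarrow> 's vctx \<Rightarrow> 's mctx \<Rightarrow> 's minst \<Rightarrow> bool" where
  "raw_inst \<Sigma> \<Theta> \<Gamma> \<Xi> I \<longleftrightarrow> map fst I = map fst \<Xi> \<and>
    (\<forall>i<length \<Xi>. raw_arg \<Sigma> (mvar_ar \<Theta>) (cdom \<Gamma>) 0 (ar (snd (\<Xi> ! i))) (snd (I ! i)))"

primrec inst :: "'s minst \<Rightarrow> 's expr \<Rightarrow> 's expr" where
  "inst I (FVar a) = FVar a"
| "inst I (BVar i) = BVar i"
| "inst I (Sym S es) = Sym S (map (inst I) es)"
| "inst I (Meta M ts) =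
    (case map_of I M of
       None \<Rightarrow> Meta M (map (inst I) ts)
     | Some e \<Rightarrow> esubst (vec (map (inst I) ts)) (unabs (length ts) e))"
| "inst I Star = Star"
| "inst I (Abs e) = Abs (inst I e)"


section \<open>Raw rules and derivability\<close>

type_synonym 's rule = "'s mctx \<times> 's expr jthesis"

definition raw_rule :: "'s signature \<Rightarrow> 's rule \<Rightarrow> bool" where
  "raw_rule \<Sigma> R \<longleftrightarrow> raw_mctx \<Sigma> (fst R) \<and> raw_jthesis \<Sigma> (mvar_ar (fst R)) {} 0 (snd R)"

text \<open>
  Derivability of judgements and of boundaries, over a set \<open>T\<close> of specific rules. Judgements are
  formed from raw syntax only; the side conditions \<open>raw_\<dots>\<close> say so where it does not follow
  from the premises.
\<close>

inductive jder :: "'s signature \<Rightarrow> 's rule set \<Rightarrow> 's mctx \<Rightarrow> 's vctx \<Rightarrow> 's expr judgement \<Rightarrow> bool"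
  and bder :: "'s signature \<Rightarrow> 's rule set \<Rightarrow> 's mctx \<Rightarrow> 's vctx \<Rightarrow> 's expr boundary \<Rightarrow> bool"
  for \<Sigma> T where
  var: "raw_ctxs \<Sigma> \<Theta> \<Gamma> \<Longrightarrow> map_of \<Gamma> a = Some A \<Longrightarrow> jder \<Sigma> T \<Theta> \<Gamma> (JThesis (HasType (FVar a) A))"
| meta:
    "map_of \<Theta> M = Some (babs As \<beta>) \<Longrightarrow> length ts = length As \<Longrightarrow>
     (\<And>j. j < length As \<Longrightarrow>
        jder \<Sigma> T \<Theta> \<Gamma> (JThesis (HasType (ts ! j) (esubst (vec (take j ts)) (As ! j))))) \<Longrightarrow>
     bder \<Sigma> T \<Theta> \<Gamma> (BThesis (map_bthesis (esubst (vec ts)) \<beta>)) \<Longrightarrow>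
     jder \<Sigma> T \<Theta> \<Gamma> (JThesis (fill (map_bthesis (esubst (vec ts)) \<beta>) (Meta M ts)))"
| meta_congr:
    "raw_ctxs \<Sigma> \<Theta> \<Gamma> \<Longrightarrow>
     map_of \<Theta> M = Some (babs As \<beta>) \<Longrightarrow> object_cls (bclass \<beta>) \<Longrightarrow>
     length ss = length As \<Longrightarrow> length ts = length As \<Longrightarrow>
     (\<And>j. j < length As \<Longrightarrow>
        jder \<Sigma> T \<Theta> \<Gamma> (JThesis (HasType (ss ! j) (esubst (vec (take j ss)) (As ! j))))) \<Longrightarrow>
     (\<And>j. j < length As \<Longrightarrow>
        jder \<Sigma> T \<Theta> \<Gamma> (JThesis (HasType (ts ! j) (esubst (vec (take j ts)) (As ! j))))) \<Longrightarrow>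
     (\<And>j. j < length As \<Longrightarrow>
        jder \<Sigma> T \<Theta> \<Gamma> (JThesis (TermEq (ss ! j) (ts ! j) (esubst (vec (take j ss)) (As ! j))))) \<Longrightarrow>
     (\<And>C. \<beta> = TermB C \<Longrightarrow>
        jder \<Sigma> T \<Theta> \<Gamma> (JThesis (TypeEq (esubst (vec ss) C) (esubst (vec ts) C)))) \<Longrightarrow>
     jder \<Sigma> T \<Theta> \<Gamma>
       (JThesis (fill_eq (map_bthesis (esubst (vec ss)) \<beta>) (Meta M ss) (Meta M ts)))"
| abstr:
    "jder \<Sigma> T \<Theta> \<Gamma> (JThesis (IsType A)) \<Longrightarrow> a \<notin> cdom \<Gamma> \<Longrightarrow>
     raw_judgement \<Sigma> (mvar_ar \<Theta>) (cdom \<Gamma>) 0 (JAbs A J) \<Longrightarrow>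
     jder \<Sigma> T \<Theta> (\<Gamma> @ [(a, A)]) (jsubst (vec [FVar a]) J) \<Longrightarrow>
     jder \<Sigma> T \<Theta> \<Gamma> (JAbs A J)"
| type_refl: "jder \<Sigma> T \<Theta> \<Gamma> (JThesis (IsType A)) \<Longrightarrow> jder \<Sigma> T \<Theta> \<Gamma> (JThesis (TypeEq A A))"
| type_sym: "jder \<Sigma> T \<Theta> \<Gamma> (JThesis (TypeEq A B)) \<Longrightarrow> jder \<Sigma> T \<Theta> \<Gamma> (JThesis (TypeEq B A))"
| type_trans:
    "jder \<Sigma> T \<Theta> \<Gamma> (JThesis (TypeEq A B)) \<Longrightarrow> jder \<Sigma> T \<Theta> \<Gamma> (JThesis (TypeEq B C)) \<Longrightarrow>
     jder \<Sigma> T \<Theta> \<Gamma> (JThesis (TypeEq A C))"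
| term_refl: "jder \<Sigma> T \<Theta> \<Gamma> (JThesis (HasType t A)) \<Longrightarrow> jder \<Sigma> T \<Theta> \<Gamma> (JThesis (TermEq t t A))"
| term_sym: "jder \<Sigma> T \<Theta> \<Gamma> (JThesis (TermEq s t A)) \<Longrightarrow> jder \<Sigma> T \<Theta> \<Gamma> (JThesis (TermEq t s A))"
| term_trans:
    "jder \<Sigma> T \<Theta> \<Gamma> (JThesis (TermEq s t A)) \<Longrightarrow> jder \<Sigma> T \<Theta> \<Gamma> (JThesis (TermEq t u A)) \<Longrightarrow>
     jder \<Sigma> T \<Theta> \<Gamma> (JThesis (TermEq s u A))"
| conv:
    "jder \<Sigma> T \<Theta> \<Gamma> (JThesis (HasType t A)) \<Longrightarrow> jder \<Sigma> T \<Theta> \<Gamma> (JThesis (TypeEq A B)) \<Longrightarrow>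
     jder \<Sigma> T \<Theta> \<Gamma> (JThesis (HasType t B))"
| conv_eq:
    "jder \<Sigma> T \<Theta> \<Gamma> (JThesis (TermEq s t A)) \<Longrightarrow> jder \<Sigma> T \<Theta> \<Gamma> (JThesis (TypeEq A B)) \<Longrightarrow>
     jder \<Sigma> T \<Theta> \<Gamma> (JThesis (TermEq s t B))"
| specific:
    "(\<Xi>, fill \<beta> e) \<in> T \<Longrightarrow> raw_ctxs \<Sigma> \<Theta> \<Gamma> \<Longrightarrow> raw_inst \<Sigma> \<Theta> \<Gamma> \<Xi> I \<Longrightarrow>
     (\<And>i. i < length \<Xi> \<Longrightarrow>
        jder \<Sigma> T \<Theta> \<Gamma> (bfill (map_boundary (inst (take i I)) (snd (\<Xi> ! i))) (snd (I ! i)))) \<Longrightarrow>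
     bder \<Sigma> T \<Theta> \<Gamma> (BThesis (map_bthesis (inst I) \<beta>)) \<Longrightarrow>
     jder \<Sigma> T \<Theta> \<Gamma> (JThesis (map_jthesis (inst I) (fill \<beta> e)))"
| congr:
    "(\<Xi>, fill \<beta> e) \<in> T \<Longrightarrow> object_cls (bclass \<beta>) \<Longrightarrow> raw_ctxs \<Sigma> \<Theta> \<Gamma> \<Longrightarrow>
     raw_inst \<Sigma> \<Theta> \<Gamma> \<Xi> I \<Longrightarrow> raw_inst \<Sigma> \<Theta> \<Gamma> \<Xi> J \<Longrightarrow>
     (\<And>i. i < length \<Xi> \<Longrightarrow>
        jder \<Sigma> T \<Theta> \<Gamma> (bfill (map_boundary (inst (take i I)) (snd (\<Xi> ! i))) (snd (I ! i)))) \<Longrightarrow>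
     (\<And>i. i < length \<Xi> \<Longrightarrow>
        jder \<Sigma> T \<Theta> \<Gamma> (bfill (map_boundary (inst (take i J)) (snd (\<Xi> ! i))) (snd (J ! i)))) \<Longrightarrow>
     (\<And>i. i < length \<Xi> \<Longrightarrow> object_bdry (snd (\<Xi> ! i)) \<Longrightarrow>
        jder \<Sigma> T \<Theta> \<Gamma>
          (bfill_eq (map_boundary (inst (take i I)) (snd (\<Xi> ! i))) (snd (I ! i)) (snd (J ! i)))) \<Longrightarrow>
     (\<And>B. \<beta> = TermB B \<Longrightarrow> jder \<Sigma> T \<Theta> \<Gamma> (JThesis (TypeEq (inst I B) (inst J B)))) \<Longrightarrow>
     jder \<Sigma> T \<Theta> \<Gamma> (JThesis (fill_eq (map_bthesis (inst I) \<beta>) (inst I e) (inst J e)))"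
| bdry_type: "raw_ctxs \<Sigma> \<Theta> \<Gamma> \<Longrightarrow> bder \<Sigma> T \<Theta> \<Gamma> (BThesis TypeB)"
| bdry_term: "jder \<Sigma> T \<Theta> \<Gamma> (JThesis (IsType A)) \<Longrightarrow> bder \<Sigma> T \<Theta> \<Gamma> (BThesis (TermB A))"
| bdry_type_eq:
    "jder \<Sigma> T \<Theta> \<Gamma> (JThesis (IsType A)) \<Longrightarrow> jder \<Sigma> T \<Theta> \<Gamma> (JThesis (IsType B)) \<Longrightarrow>
     bder \<Sigma> T \<Theta> \<Gamma> (BThesis (TypeEqB A B))"
| bdry_term_eq:
    "jder \<Sigma> T \<Theta> \<Gamma> (JThesis (IsType A)) \<Longrightarrow>
     jder \<Sigma> T \<Theta> \<Gamma> (JThesis (HasType s A)) \<Longrightarrow> jder \<Sigma> T \<Theta> \<Gamma> (JThesis (HasType t A)) \<Longrightarrow>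
     bder \<Sigma> T \<Theta> \<Gamma> (BThesis (TermEqB s t A))"
| bdry_abstr:
    "jder \<Sigma> T \<Theta> \<Gamma> (JThesis (IsType A)) \<Longrightarrow> a \<notin> cdom \<Gamma> \<Longrightarrow>
     raw_boundary \<Sigma> (mvar_ar \<Theta>) (cdom \<Gamma>) 0 (BAbs A B) \<Longrightarrow>
     bder \<Sigma> T \<Theta> (\<Gamma> @ [(a, A)]) (bsubst (vec [FVar a]) B) \<Longrightarrow>
     bder \<Sigma> T \<Theta> \<Gamma> (BAbs A B)"

inductive wf_mctx :: "'s signature \<Rightarrow> 's rule set \<Rightarrow> 's mctx \<Rightarrow> bool" for \<Sigma> T where
  "wf_mctx \<Sigma> T []"
| "wf_mctx \<Sigma> T \<Theta> \<Longrightarrow> bder \<Sigma> T \<Theta> [] B \<Longrightarrow> M \<notin> cdom \<Theta> \<Longrightarrow> wf_mctx \<Sigma> T (\<Theta> @ [(M, B)])"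

inductive wf_vctx :: "'s signature \<Rightarrow> 's rule set \<Rightarrow> 's mctx \<Rightarrow> 's vctx \<Rightarrow> bool" for \<Sigma> T \<Theta> where
  "raw_mctx \<Sigma> \<Theta> \<Longrightarrow> wf_vctx \<Sigma> T \<Theta> []"
| "wf_vctx \<Sigma> T \<Theta> \<Gamma> \<Longrightarrow> jder \<Sigma> T \<Theta> \<Gamma> (JThesis (IsType A)) \<Longrightarrow> a \<notin> cdom \<Gamma> \<Longrightarrow>
   wf_vctx \<Sigma> T \<Theta> (\<Gamma> @ [(a, A)])"


section \<open>Standard theories\<close>

text \<open>A raw type theory is a family of raw rules \<open>(R i)\<close> indexed by \<open>i \<in> I\<close>.\<close>

definition raw_theory :: "'s signature \<Rightarrow> 'i set \<Rightarrow> ('i \<Rightarrow> 's rule) \<Rightarrow> bool" where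
  "raw_theory \<Sigma> I R \<longleftrightarrow> signature \<Sigma> \<and> (\<forall>i\<in>I. raw_rule \<Sigma> (R i))"

definition finitary_rule :: "'s signature \<Rightarrow> 's rule set \<Rightarrow> 's rule \<Rightarrow> bool" where
  "finitary_rule \<Sigma> T R \<longleftrightarrow>
    (\<exists>\<Xi> \<beta> e. R = (\<Xi>, fill \<beta> e) \<and> wf_mctx \<Sigma> T \<Xi> \<and> bder \<Sigma> T \<Xi> [] (BThesis \<beta>))"

definition finitary_theory :: "'s signature \<Rightarrow> 'i set \<Rightarrow> ('i \<Rightarrow> 's rule) \<Rightarrow> bool" where
  "finitary_theory \<Sigma> I R \<longleftrightarrow> raw_theory \<Sigma> I R \<and>
    (\<exists>prec. prec \<subseteq> I \<times> I \<and> trans prec \<and> wf prec \<and>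
      (\<forall>i\<in>I. finitary_rule \<Sigma> (R ` {j \<in> I. (j, i) \<in> prec}) (R i)))"

definition generic :: "mvar \<times> 's expr boundary \<Rightarrow> 's expr" where
  "generic MB = (case MB of (M, B) \<Rightarrow> case ar B of (c, k) \<Rightarrow>
    (Abs ^^ k) (if object_cls c then Meta M (map BVar (rev [0..<k])) else Star))"

definition symbol_rule :: "'s signature \<Rightarrow> 's \<Rightarrow> 's rule \<Rightarrow> bool" where
  "symbol_rule \<Sigma> S R \<longleftrightarrow>
    (\<exists>\<Xi> \<beta>. raw_mctx \<Sigma> \<Xi> \<and> raw_bthesis \<Sigma> (mvar_ar \<Xi>) {} 0 \<beta> \<and> object_cls (bclass \<beta>) \<and>
      \<Sigma> S = Some (bclass \<beta>, map (ar \<circ> snd) \<Xi>) \<and>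
      R = (\<Xi>, fill \<beta> (Sym S (map generic \<Xi>))))"

definition object_rule :: "'s rule \<Rightarrow> bool" where
  "object_rule R \<longleftrightarrow> (\<exists>\<Xi> \<beta> e. R = (\<Xi>, fill \<beta> e) \<and> object_cls (bclass \<beta>))"

definition standard_theory :: "'s signature \<Rightarrow> 'i set \<Rightarrow> ('i \<Rightarrow> 's rule) \<Rightarrow> bool" where
  "standard_theory \<Sigma> I R \<longleftrightarrow> finitary_theory \<Sigma> I R \<and>
    (\<forall>i\<in>I. object_rule (R i) \<longrightarrow> (\<exists>S. symbol_rule \<Sigma> S (R i))) \<and>
    (\<forall>S\<in>dom \<Sigma>. \<exists>!i. i \<in> I \<and> symbol_rule \<Sigma> S (R i))"


section \<open>Typing in ill-formed variable contexts\<close>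

text \<open>
  The variable rule has no premises, so a variable of an ill-formed variable context may have a
  \<open>type\<close> that is not derivably a type, and then is not derivably equal to itself. Over the empty
  theory this happens for \<open>b\<close> in \<open>N type, N' type, P : {x:N} \<box> type; a : N', b : P(a)\<close>.
  Hence uniqueness of typing needs a well-formed variable context if the term is a variable and
  both types are the same expression.
\<close>

lemma standard_theory_empty: "standard_theory Map.empty {} R"
  by (auto simp: standard_theory_def finitary_theory_def raw_theory_def signature_def)

lemma ill_formed_vctx_no_refl:
  fixes \<Theta> :: "'s mctx" and \<Gamma> :: "'s vctx"
  defines "\<Theta> \<equiv> [(0, BThesis TypeB), (1, BThesis TypeB), (2, BAbs (Meta 0 []) (BThesis TypeB))]"
    and "\<Gamma> \<equiv> [(0, Meta 1 []), (1, Meta 2 [FVar 0])]"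
  shows "wf_mctx Map.empty {} \<Theta>"
    and "jder Map.empty {} \<Theta> \<Gamma> (JThesis (HasType (FVar 1) (Meta 2 [FVar 0])))"
    and "\<not> jder Map.empty {} \<Theta> \<Gamma> (JThesis (TypeEq (Meta 2 [FVar 0]) (Meta 2 [FVar 0])))"
proof -
  have raw_Meta_iff: "raw_arg \<Sigma> D V k (Ty, 0) (Meta M ts) \<longleftrightarrow>
      D M = Some (Ty, length ts) \<and> list_all (raw_arg \<Sigma> D V k (Tm, 0)) ts"
    and raw_FVar_iff: "raw_arg \<Sigma> D V k (Tm, 0) (FVar a) \<longleftrightarrow> a \<in> V"
    for \<Sigma> :: "'s signature" and D V k M ts a
    by (auto simp: object_cls_def elim: raw_arg.cases intro: raw_arg.intros)
  note raw_simps = raw_Meta_iff raw_FVar_iff raw_ctxs_def raw_mctx_def raw_vctx_def less_Suc_eq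
    mvar_ar_def cdom_def numeral_2_eq_2

  define \<Theta>' :: "'s mctx" where "\<Theta>' = [(0, BThesis TypeB), (1, BThesis TypeB)]"
  have N: "jder Map.empty {} \<Theta>' [] (JThesis (IsType (Meta 0 [])))"
    using meta[of \<Theta>' 0 "[]" TypeB "[]" Map.empty "{}" "[]"]
    by (simp add: \<Theta>'_def bdry_type raw_simps)
  have P: "bder Map.empty {} \<Theta>' [] (BAbs (Meta 0 []) (BThesis TypeB))"
    by (rule bdry_abstr[OF N, where a = 0]) (auto simp: \<Theta>'_def raw_simps intro!: bdry_type)
  have "wf_mctx Map.empty {} ([] @ [(0, BThesis TypeB)] :: 's mctx)"
    by (intro wf_mctx.intros bdry_type) (auto simp: raw_simps)
  then have "wf_mctx Map.empty {} ([(0, BThesis TypeB)] @ [(1, BThesis TypeB)] :: 's mctx)"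
    by (intro wf_mctx.intros bdry_type) (auto simp: raw_simps)
  then have "wf_mctx Map.empty {} (\<Theta>' @ [(2, BAbs (Meta 0 []) (BThesis TypeB))])"
    by (intro wf_mctx.intros P) (auto simp: \<Theta>'_def cdom_def)
  then show "wf_mctx Map.empty {} \<Theta>"
    by (simp add: \<Theta>_def \<Theta>'_def)

  have "raw_ctxs Map.empty \<Theta> \<Gamma>"
    by (simp add: \<Theta>_def \<Gamma>_def raw_simps all_conj_distrib)
  then show "jder Map.empty {} \<Theta> \<Gamma> (JThesis (HasType (FVar 1) (Meta 2 [FVar 0])))"
    by (rule var) (simp add: \<Gamma>_def)

  define ok :: "'s expr judgement \<Rightarrow> bool" where
    "ok J = (case J of JAbs _ _ \<Rightarrow> True | JThesis j \<Rightarrow> (case j of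
        IsType A \<Rightarrow> A \<in> {Meta 0 [], Meta 1 []}
      | HasType t A \<Rightarrow> (t, A) \<in> {(FVar 0, Meta 1 []), (FVar 1, Meta 2 [FVar 0])}
      | TypeEq A B \<Rightarrow> A = B \<and> A \<in> {Meta 0 [], Meta 1 []}
      | TermEq s t A \<Rightarrow> s = t \<and> (s, A) \<in> {(FVar 0, Meta 1 []), (FVar 1, Meta 2 [FVar 0])}))" for J
  have babs_iff: "BThesis c = babs As b \<longleftrightarrow> As = [] \<and> b = c"
    "BAbs A B = babs As b \<longleftrightarrow> (\<exists>As'. As = A # As' \<and> B = babs As' b)"
    for c b :: "'s expr bthesis" and A B As
    by (cases As; auto)+
  have "ok J" if "jder \<Sigma> {} \<Theta> \<Gamma> J" for \<Sigma> J
  proof -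
    have "jder \<Sigma> T \<Theta>'' \<Gamma>'' J \<Longrightarrow> T = {} \<Longrightarrow> \<Theta>'' = \<Theta> \<Longrightarrow> \<Gamma>'' = \<Gamma> \<Longrightarrow> ok J"
      "bder \<Sigma> T \<Theta>'' \<Gamma>'' B \<Longrightarrow> True" for T \<Theta>'' \<Gamma>'' B
    proof (induction rule: jder_bder.inducts)
      case var
      then show ?case by (auto simp: \<Gamma>_def ok_def split: if_splits)
    next
      case meta
      show ?case using meta.hyps meta.prems meta.IH(2)[of 0]
        by (auto simp: \<Theta>_def ok_def babs_iff length_Suc_conv split: if_splits)
    next
      case meta_congr
      show ?case using meta_congr.hyps meta_congr.prems meta_congr.IH(3)[of 0]
        by (auto simp: \<Theta>_def ok_def babs_iff split: if_splits)
    qed (auto simp: ok_def)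
    then show ?thesis using that by blast
  qed
  from this[of Map.empty "JThesis (TypeEq (Meta 2 [FVar 0]) (Meta 2 [FVar 0]))"]
  show "\<not> jder Map.empty {} \<Theta> \<Gamma> (JThesis (TypeEq (Meta 2 [FVar 0]) (Meta 2 [FVar 0])))"
    by (auto simp: ok_def)
qed

end

theory Submission
  imports Defs
begin

text \<open>
  Every derivation of \<open>t : A\<close> ends in conversions applied to a variable, metavariable or symbol
  rule. That rule assigns to \<open>t\<close> a natural type which is determined by \<open>t\<close> alone: for a symbol, the
  theory has only one rule for it, and the arguments determine the instantiation. Hence any two
  types of \<open>t\<close> are equal to its natural type. The symbol and metavariable rules have as a premise
  that the natural type is a type, so reflexivity is problematic only for variables; there one
  weakens from the prefix of the context in which the type of the variable was formed. For
  equations, the presuppositions reduce the second claim to the first.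
\<close>

section \<open>Renaming of free variables\<close>

primrec ren :: "(fvar \<Rightarrow> fvar) \<Rightarrow> 's expr \<Rightarrow> 's expr" where
  "ren f (FVar a) = FVar (f a)"
| "ren f (BVar i) = BVar i"
| "ren f (Sym S es) = Sym S (map (ren f) es)"
| "ren f (Meta M ts) = Meta M (map (ren f) ts)"
| "ren f Star = Star"
| "ren f (Abs e) = Abs (ren f e)"

definition ren_inst :: "(fvar \<Rightarrow> fvar) \<Rightarrow> 's minst \<Rightarrow> 's minst" where
  "ren_inst f I = map (\<lambda>(M, e). (M, ren f e)) I"

text \<open>Only lookups are compared, so inclusions of contexts, permutations and changes of names
  are all instances.\<close>

definition ren_vctx :: "(fvar \<Rightarrow> fvar) \<Rightarrow> 's vctx \<Rightarrow> 's vctx \<Rightarrow> bool" where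
  "ren_vctx f \<Gamma> \<Gamma>' \<longleftrightarrow> (\<forall>a A. map_of \<Gamma> a = Some A \<longrightarrow> map_of \<Gamma>' (f a) = Some (ren f A))"

section \<open>Mapping over theses, filled boundaries and abstraction prefixes\<close>

lemma bclass_map [simp]: "bclass (map_bthesis g \<beta>) = bclass \<beta>"
  by (cases \<beta>) auto

lemma ar_map [simp]: "ar (map_boundary g B) = ar B"
  by (induction B) auto

lemma map_fill: "map_jthesis g (fill \<beta> e) = fill (map_bthesis g \<beta>) (g e)"
  by (cases \<beta>) auto

text \<open>The class restriction is there because \<open>fill_eq\<close> is unspecified on equality
  boundaries.\<close>

lemma map_fill_eq:
  "object_cls (bclass \<beta>) \<Longrightarrow>
    map_jthesis g (fill_eq \<beta> e\<^sub>1 e\<^sub>2) = fill_eq (map_bthesis g \<beta>) (g e\<^sub>1) (g e\<^sub>2)"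
  by (cases \<beta>) (auto simp: object_cls_def)

text \<open>The metavariable rules mention \<open>As\<close> and \<beta> only through an equation
  with \<open>babs As \<beta>\<close>; this recovers both from the declared boundary.\<close>

lemma babs_eq_iff: "babs As \<beta> = babs As' \<beta>' \<longleftrightarrow> As = As' \<and> \<beta> = \<beta>'"
proof (induction As arbitrary: As')
  case Nil
  then show ?case by (cases As') auto
next
  case (Cons A As)
  then show ?case by (cases As') auto
qed

lemma map_babs: "map_boundary g (babs As \<beta>) = babs (map g As) (map_bthesis g \<beta>)"
  by (induction As) auto

section \<open>Renaming commutes with substitution for bound variables\<close>

lemma ren_shift: "ren f (shift k e) = shift k (ren f e)"
  by (induction e arbitrary: k) auto

lemma ren_up: "ren f \<circ> up \<sigma> = up (ren f \<circ> \<sigma>)"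
  by (rule ext) (auto simp: up_def ren_shift split: nat.split)

lemma ren_esubst: "ren f (esubst \<sigma> e) = esubst (ren f \<circ> \<sigma>) (ren f e)"
  by (induction e arbitrary: \<sigma>) (auto simp: ren_up)

lemma ren_jsubst: "map_judgement (ren f) (jsubst \<sigma> J) = jsubst (ren f \<circ> \<sigma>) (map_judgement (ren f) J)"
proof (induction J arbitrary: \<sigma>)
  case (JThesis j)
  then show ?case by (cases j) (auto simp: ren_esubst comp_def)
qed (auto simp: ren_esubst ren_up)

lemma ren_map_bthesis:
  "map_bthesis (ren f) (map_bthesis (esubst \<sigma>) \<beta>) =
    map_bthesis (esubst (ren f \<circ> \<sigma>)) (map_bthesis (ren f) \<beta>)"
  by (cases \<beta>) (auto simp: ren_esubst)

lemma ren_bsubst: "map_boundary (ren f) (bsubst \<sigma> B) = bsubst (ren f \<circ> \<sigma>) (map_boundary (ren f) B)"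
  by (induction B arbitrary: \<sigma>) (auto simp: ren_esubst ren_up ren_map_bthesis)

lemma ren_vec: "ren f \<circ> vec ts = vec (map (ren f) ts)"
  by (rule ext) (auto simp: vec_def)

section \<open>Renaming of raw syntax\<close>

lemma raw_arg_ren:
  "raw_arg \<Sigma> D V k \<alpha> e \<Longrightarrow> f ` V \<subseteq> V' \<Longrightarrow> raw_arg \<Sigma> D V' k \<alpha> (ren f e)"
proof (induction rule: raw_arg.induct)
  case (raw_Sym S c ars k es)
  then show ?case
    by (auto simp: list_all2_conv_all_nth intro!: raw_arg.raw_Sym)
next
  case (raw_Meta M c ts k)
  then show ?case
    by (auto simp: list_all_iff intro!: raw_arg.raw_Meta)
qed (auto intro: raw_arg.intros)

text \<open>All free variables of a raw expression lie in \<open>V\<close>. In the main use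
  \<open>V\<close> is the domain of a context and the two renamings differ only at a fresh
  variable.\<close>

lemma ren_cong_raw:
  "raw_arg \<Sigma> D V k \<alpha> e \<Longrightarrow> (\<And>a. a \<in> V \<Longrightarrow> f a = g a) \<Longrightarrow> ren f e = ren g e"
proof (induction rule: raw_arg.induct)
  case (raw_Sym S c ars k es)
  then show ?case by (fastforce simp: list_all2_conv_all_nth in_set_conv_nth intro!: map_idI)
next
  case (raw_Meta M c ts k)
  then show ?case by (auto simp: list_all_iff)
qed auto

lemma ren_id: "ren (\<lambda>a. a) = (\<lambda>e. e)"
proof
  show "ren (\<lambda>a. a) e = e" for e :: "'a expr"
    by (induction e) (auto simp: map_idI)
qed

lemma raw_judgement_ren:
  assumes "f ` V \<subseteq> V'"
  shows "raw_judgement \<Sigma> D V k J \<Longrightarrow> raw_judgement \<Sigma> D V' k (map_judgement (ren f) J)"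
proof (induction J arbitrary: k)
  case (JThesis j)
  then show ?case by (cases j) (auto intro: raw_arg_ren[OF _ assms])
qed (auto intro: raw_arg_ren[OF _ assms])

lemma raw_boundary_ren:
  assumes "f ` V \<subseteq> V'"
  shows "raw_boundary \<Sigma> D V k B \<Longrightarrow> raw_boundary \<Sigma> D V' k (map_boundary (ren f) B)"
proof (induction B arbitrary: k)
  case (BThesis \<beta>)
  then show ?case by (cases \<beta>) (auto intro: raw_arg_ren[OF _ assms])
qed (auto intro: raw_arg_ren[OF _ assms])

lemma judgement_ren_cong_raw:
  assumes "\<And>a. a \<in> V \<Longrightarrow> f a = g a"
  shows "raw_judgement \<Sigma> D V k J \<Longrightarrow> map_judgement (ren f) J = map_judgement (ren g) J"
proof (induction J arbitrary: k)
  case (JThesis j)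
  then show ?case by (cases j) (auto intro: ren_cong_raw[OF _ assms])
qed (auto intro: ren_cong_raw[OF _ assms])

lemma boundary_ren_cong_raw:
  assumes "\<And>a. a \<in> V \<Longrightarrow> f a = g a"
  shows "raw_boundary \<Sigma> D V k B \<Longrightarrow> map_boundary (ren f) B = map_boundary (ren g) B"
proof (induction B arbitrary: k)
  case (BThesis \<beta>)
  then show ?case by (cases \<beta>) (auto intro: ren_cong_raw[OF _ assms])
qed (auto intro: ren_cong_raw[OF _ assms])

text \<open>On an empty set of free variables every renaming agrees with the identity.\<close>

lemma boundary_ren_closed: "raw_boundary \<Sigma> D {} k B \<Longrightarrow> map_boundary (ren f) B = B"
  using boundary_ren_cong_raw[of "{}" f "\<lambda>a. a" \<Sigma> D k B]
  by (simp add: ren_id boundary.map_ident)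

section \<open>Instantiations\<close>

lemma raw_arg_SucE:
  assumes "raw_arg \<Sigma> D V k (c, Suc n) e"
  obtains e' where "e = Abs e'" "raw_arg \<Sigma> D V (Suc k) (c, n) e'"
  using assms by (cases rule: raw_arg.cases) auto

text \<open>The arity supplies the \<open>n\<close> outer abstractions, without which
  \<open>unabs\<close> is unspecified.\<close>

lemma ren_unabs: "raw_arg \<Sigma> D V k (c, n) e \<Longrightarrow> ren f (unabs n e) = unabs n (ren f e)"
  by (induction n arbitrary: k e) (auto elim!: raw_arg_SucE)

text \<open>Pairing each declaration with its argument gives a form suited to list induction and to
  truncation.\<close>

lemma raw_inst_list_all2:
  "raw_inst \<Sigma> \<Theta> \<Gamma> \<Xi> I \<longleftrightarrow>
    list_all2 (\<lambda>X E. fst E = fst X \<and> raw_arg \<Sigma> (mvar_ar \<Theta>) (cdom \<Gamma>) 0 (ar (snd X)) (snd E)) \<Xi> I"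
proof -
  have "map fst I = map fst \<Xi> \<longleftrightarrow>
      length \<Xi> = length I \<and> (\<forall>i<length \<Xi>. fst (I ! i) = fst (\<Xi> ! i))"
    by (auto simp: list_eq_iff_nth_eq)
  then show ?thesis
    by (auto simp: raw_inst_def list_all2_conv_all_nth)
qed

lemma raw_inst_length: "raw_inst \<Sigma> \<Theta> \<Gamma> \<Xi> I \<Longrightarrow> length I = length \<Xi>"
  by (metis raw_inst_def length_map)

lemma raw_inst_take: "raw_inst \<Sigma> \<Theta> \<Gamma> \<Xi> I \<Longrightarrow> raw_inst \<Sigma> \<Theta> \<Gamma> (take i \<Xi>) (take i I)"
  unfolding raw_inst_list_all2 by (rule list_all2_takeI)

text \<open>Both lists have the same keys in the same order, so the two lookups stop at the same
  position.\<close>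

lemma raw_inst_lookup:
  assumes "raw_inst \<Sigma> \<Theta> \<Gamma> \<Xi> I" "mvar_ar \<Xi> M = Some \<alpha>"
  obtains e where "map_of I M = Some e" "raw_arg \<Sigma> (mvar_ar \<Theta>) (cdom \<Gamma>) 0 \<alpha> e"
proof -
  have "\<exists>e. map_of I M = Some e \<and> raw_arg \<Sigma> (mvar_ar \<Theta>) (cdom \<Gamma>) 0 \<alpha> e"
    using assms unfolding raw_inst_list_all2
  proof (induction rule: list_all2_induct)
    case (Cons X \<Xi> E I)
    then show ?case by (cases X; cases E)
      (auto simp: mvar_ar_def[of \<open>_ # _\<close>] mvar_ar_def[of \<Xi>] split: if_splits)
  qed (simp add: mvar_ar_def)
  then show ?thesis using that by blast
qed

lemma map_of_ren_inst: "map_of (ren_inst f I) M = map_option (ren f) (map_of I M)"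
  unfolding ren_inst_def by (induction I) auto

lemma ren_inst_take: "ren_inst f (take i I) = take i (ren_inst f I)"
  by (simp add: ren_inst_def take_map)

lemma ren_inst_nth: "i < length I \<Longrightarrow> snd (ren_inst f I ! i) = ren f (snd (I ! i))"
  by (simp add: ren_inst_def split: prod.split)

lemma raw_inst_ren:
  assumes "raw_inst \<Sigma> \<Theta> \<Gamma> \<Xi> I" "f ` cdom \<Gamma> \<subseteq> cdom \<Gamma>'"
  shows "raw_inst \<Sigma> \<Theta> \<Gamma>' \<Xi> (ren_inst f I)"
  using assms unfolding raw_inst_list_all2 ren_inst_def list.rel_map
  by (auto elim!: list_all2_mono intro: raw_arg_ren split: prod.splits)

text \<open>The expression is raw over no free variables, so every free variable of its instance
  comes from an argument of \<open>I\<close>.\<close>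

lemma ren_of_inst:
  assumes I: "raw_inst \<Sigma> \<Theta> \<Gamma> \<Xi> I"
  shows "raw_arg \<Sigma> (mvar_ar \<Xi>) {} k \<alpha> e \<Longrightarrow> ren f (inst I e) = inst (ren_inst f I) e"
proof (induction rule: raw_arg.induct)
  case (raw_Sym S c ars k es)
  then show ?case by (fastforce simp: list_all2_conv_all_nth in_set_conv_nth intro!: map_idI)
next
  case (raw_Meta M c ts k)
  from raw_inst_lookup[OF I raw_Meta(1)] obtain e'
    where e': "map_of I M = Some e'" "raw_arg \<Sigma> (mvar_ar \<Theta>) (cdom \<Gamma>) 0 (c, length ts) e'" .
  have "map (ren f \<circ> inst I) ts = map (inst (ren_inst f I)) ts"
    using raw_Meta.IH by (auto simp: list_all_iff)
  then show ?case
    using e'(1) by (simp del: map_eq_conv add: map_of_ren_inst ren_esubst ren_vec ren_unabs[OF e'(2)])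
qed auto

lemma ren_inst_jthesis:
  assumes "raw_inst \<Sigma> \<Theta> \<Gamma> \<Xi> I" "raw_jthesis \<Sigma> (mvar_ar \<Xi>) {} k j"
  shows "map_jthesis (ren f) (map_jthesis (inst I) j) = map_jthesis (inst (ren_inst f I)) j"
  using assms(2) by (cases j) (auto intro: ren_of_inst[OF assms(1)])

lemma ren_inst_bthesis:
  assumes "raw_inst \<Sigma> \<Theta> \<Gamma> \<Xi> I" "raw_bthesis \<Sigma> (mvar_ar \<Xi>) {} k \<beta>"
  shows "map_bthesis (ren f) (map_bthesis (inst I) \<beta>) = map_bthesis (inst (ren_inst f I)) \<beta>"
  using assms(2) by (cases \<beta>) (auto intro: ren_of_inst[OF assms(1)])

lemma ren_inst_boundary:
  assumes "raw_inst \<Sigma> \<Theta> \<Gamma> \<Xi> I"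
  shows "raw_boundary \<Sigma> (mvar_ar \<Xi>) {} k B \<Longrightarrow>
    map_boundary (ren f) (map_boundary (inst I) B) = map_boundary (inst (ren_inst f I)) B"
  by (induction B arbitrary: k) (auto intro: ren_of_inst[OF assms] simp: ren_inst_bthesis[OF assms])

text \<open>The arity makes the abstractions of \<open>e\<close> match those of \<open>B\<close>, as
  \<open>bfill\<close> is otherwise unspecified.\<close>

lemma ren_bfill:
  "raw_arg \<Sigma> D V k (ar B) e \<Longrightarrow>
    map_judgement (ren f) (bfill B e) = bfill (map_boundary (ren f) B) (ren f e)"
  by (induction B arbitrary: k e) (auto simp: map_fill elim!: raw_arg_SucE)

lemma ren_bfill_eq:
  "raw_arg \<Sigma> D V k (ar B) e\<^sub>1 \<Longrightarrow> raw_arg \<Sigma> D V k (ar B) e\<^sub>2 \<Longrightarrow> object_bdry B \<Longrightarrow>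
    map_judgement (ren f) (bfill_eq B e\<^sub>1 e\<^sub>2) =
      bfill_eq (map_boundary (ren f) B) (ren f e\<^sub>1) (ren f e\<^sub>2)"
  by (induction B arbitrary: k e\<^sub>1 e\<^sub>2) (auto simp: map_fill_eq object_bdry_def elim!: raw_arg_SucE)

text \<open>The boundary at position \<open>i\<close> mentions only earlier metavariables, and
  \<open>take i I\<close> is an instantiation of exactly these, so the commutation of renaming with
  instantiation applies to it.\<close>

lemma ren_premise:
  assumes "raw_inst \<Sigma> \<Theta> \<Gamma> \<Xi> I" "raw_mctx \<Sigma> \<Xi>" "i < length \<Xi>"
  shows "map_judgement (ren f) (bfill (map_boundary (inst (take i I)) (snd (\<Xi> ! i))) (snd (I ! i))) =
    bfill (map_boundary (inst (take i (ren_inst f I))) (snd (\<Xi> ! i))) (snd (ren_inst f I ! i))"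
proof -
  have "raw_arg \<Sigma> (mvar_ar \<Theta>) (cdom \<Gamma>) 0 (ar (map_boundary (inst (take i I)) (snd (\<Xi> ! i)))) (snd (I ! i))"
    using assms by (simp add: raw_inst_def)
  from ren_bfill[OF this] show ?thesis
    using assms ren_inst_boundary[OF raw_inst_take[OF assms(1)]]
    by (auto simp: raw_mctx_def ren_inst_nth ren_inst_take raw_inst_length[OF assms(1)])
qed

lemma ren_premise_eq:
  assumes "raw_inst \<Sigma> \<Theta> \<Gamma> \<Xi> I" "raw_inst \<Sigma> \<Theta> \<Gamma> \<Xi> J" "raw_mctx \<Sigma> \<Xi>" "i < length \<Xi>"
    and "object_bdry (snd (\<Xi> ! i))"
  shows "map_judgement (ren f)
      (bfill_eq (map_boundary (inst (take i I)) (snd (\<Xi> ! i))) (snd (I ! i)) (snd (J ! i))) =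
    bfill_eq (map_boundary (inst (take i (ren_inst f I))) (snd (\<Xi> ! i)))
      (snd (ren_inst f I ! i)) (snd (ren_inst f J ! i))"
proof -
  let ?B = "map_boundary (inst (take i I)) (snd (\<Xi> ! i))"
  have "raw_arg \<Sigma> (mvar_ar \<Theta>) (cdom \<Gamma>) 0 (ar ?B) (snd (I ! i))"
    "raw_arg \<Sigma> (mvar_ar \<Theta>) (cdom \<Gamma>) 0 (ar ?B) (snd (J ! i))" "object_bdry ?B"
    using assms by (simp_all add: raw_inst_def object_bdry_def)
  from ren_bfill_eq[OF this] show ?thesis
    using assms ren_inst_boundary[OF raw_inst_take[OF assms(1)]]
    by (auto simp: raw_mctx_def ren_inst_nth ren_inst_take raw_inst_length[OF assms(1)]
        raw_inst_length[OF assms(2)])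
qed

section \<open>Weakening\<close>

lemma raw_arg_mono: "raw_arg \<Sigma> D V k \<alpha> e \<Longrightarrow> V \<subseteq> V' \<Longrightarrow> raw_arg \<Sigma> D V' k \<alpha> e"
  using raw_arg_ren[of \<Sigma> D V k \<alpha> e "\<lambda>a. a" V'] by (simp add: ren_id)

lemma cdom_dom: "cdom \<Gamma> = dom (map_of \<Gamma>)"
  by (simp add: cdom_def dom_map_of_conv_image_fst)

text \<open>Each rule either carries this side condition or has a premise over the same
  contexts.\<close>

lemma der_raw_ctxs:
  "jder \<Sigma> T \<Theta> \<Gamma> J \<Longrightarrow> raw_ctxs \<Sigma> \<Theta> \<Gamma>"
  "bder \<Sigma> T \<Theta> \<Gamma> B \<Longrightarrow> raw_ctxs \<Sigma> \<Theta> \<Gamma>"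
  by (induction rule: jder_bder.inducts) auto

lemma raw_vctx_lookup:
  assumes "raw_vctx \<Sigma> \<Theta> \<Gamma>" "map_of \<Gamma> a = Some A"
  shows "raw_type \<Sigma> (mvar_ar \<Theta>) (cdom \<Gamma>) 0 A"
proof -
  from assms(2) obtain i where "i < length \<Gamma>" "\<Gamma> ! i = (a, A)"
    by (meson in_set_conv_nth map_of_SomeD)
  with assms(1) have "raw_type \<Sigma> (mvar_ar \<Theta>) (cdom (take i \<Gamma>)) 0 A"
    by (auto simp: raw_vctx_def)
  then show ?thesis
    by (rule raw_arg_mono) (auto simp: cdom_def dest: in_set_takeD)
qed

text \<open>What matters later is that the boundary has no free variables; the arities of the
  preceding metavariables stay existential.\<close>

lemma raw_mctx_lookup:
  assumes "raw_mctx \<Sigma> \<Theta>" "map_of \<Theta> M = Some B"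
  shows "\<exists>D. raw_boundary \<Sigma> D {} 0 B"
proof -
  from assms(2) obtain i where "i < length \<Theta>" "\<Theta> ! i = (M, B)"
    by (meson in_set_conv_nth map_of_SomeD)
  with assms(1) show ?thesis by (metis raw_mctx_def snd_conv)
qed

lemma raw_ctxs_snoc:
  assumes "raw_ctxs \<Sigma> \<Theta> \<Gamma>" "a \<notin> cdom \<Gamma>" "raw_type \<Sigma> (mvar_ar \<Theta>) (cdom \<Gamma>) 0 A"
  shows "raw_ctxs \<Sigma> \<Theta> (\<Gamma> @ [(a, A)])"
  using assms by (auto simp: raw_ctxs_def raw_vctx_def nth_append less_Suc_eq cdom_def)

lemma ren_vctx_cdom: "ren_vctx f \<Gamma> \<Gamma>' \<Longrightarrow> f ` cdom \<Gamma> \<subseteq> cdom \<Gamma>'"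
  by (auto simp: cdom_dom ren_vctx_def)

text \<open>Extends a renaming under a binder. The new variable \<open>a\<close> may clash with
  \<Gamma>', so it is sent to some \<open>b\<close> fresh for \<Gamma>'; the types in \<Gamma> do
  not mention \<open>a\<close> and keep their images.\<close>

lemma ren_vctx_snoc:
  assumes raw: "raw_ctxs \<Sigma> \<Theta> \<Gamma>" "raw_ctxs \<Sigma> \<Theta> \<Gamma>'" and f: "ren_vctx f \<Gamma> \<Gamma>'"
    and a: "a \<notin> cdom \<Gamma>" and A: "raw_type \<Sigma> (mvar_ar \<Theta>) (cdom \<Gamma>) 0 A"
  obtains b where "b \<notin> cdom \<Gamma>'" "raw_ctxs \<Sigma> \<Theta> (\<Gamma>' @ [(b, ren f A)])"
    "ren_vctx (f(a := b)) (\<Gamma> @ [(a, A)]) (\<Gamma>' @ [(b, ren f A)])"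
proof -
  have "finite (cdom \<Gamma>')" by (simp add: cdom_def)
  then obtain b where b: "b \<notin> cdom \<Gamma>'"
    using ex_new_if_finite infinite_UNIV_nat by blast
  have cong: "ren (f(a := b)) B = ren f B" if "raw_type \<Sigma> (mvar_ar \<Theta>) (cdom \<Gamma>) 0 B" for B
    using that by (rule ren_cong_raw) (use a in auto)
  have "map_of (\<Gamma>' @ [(b, ren f A)]) ((f(a := b)) x) = Some (ren (f(a := b)) B)"
    if x: "map_of (\<Gamma> @ [(a, A)]) x = Some B" for x B
  proof (cases "map_of \<Gamma> x")
    case None
    then have "x = a" "B = A" using x by (auto simp: map_add_def split: if_splits)
    \<comment> \<open>Lookup tries \<Gamma>' first; freshness of \<open>b\<close> lets it reach the
      appended entry.\<close>
    moreover have "map_of \<Gamma>' b = None" using b by (auto simp: cdom_dom)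
    ultimately show ?thesis by (simp add: cong[OF A] map_add_def)
  next
    case (Some B')
    then have B: "map_of \<Gamma> x = Some B" using x by (simp add: map_add_def)
    then have "x \<noteq> a" using a by (auto simp: cdom_dom)
    moreover have "ren (f(a := b)) B = ren f B"
      using raw(1) B by (intro cong raw_vctx_lookup) (auto simp: raw_ctxs_def)
    ultimately show ?thesis using f B by (simp add: ren_vctx_def map_add_def)
  qed
  then have "ren_vctx (f(a := b)) (\<Gamma> @ [(a, A)]) (\<Gamma>' @ [(b, ren f A)])"
    by (simp only: ren_vctx_def) blast
  moreover have "raw_ctxs \<Sigma> \<Theta> (\<Gamma>' @ [(b, ren f A)])"
    using raw_ctxs_snoc[OF raw(2) b raw_arg_ren[OF A ren_vctx_cdom[OF f]]] .
  ultimately show ?thesis using b that by blast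
qed

lemma ren_meta_boundary:
  assumes "raw_ctxs \<Sigma> \<Theta> \<Gamma>" "map_of \<Theta> M = Some (babs As \<beta>)"
  shows "j < length As \<Longrightarrow> ren f (As ! j) = As ! j" and "map_bthesis (ren f) \<beta> = \<beta>"
proof -
  obtain D where "raw_boundary \<Sigma> D {} 0 (babs As \<beta>)"
    using assms raw_mctx_lookup by (fastforce simp: raw_ctxs_def)
  then have "map (ren f) As = As \<and> map_bthesis (ren f) \<beta> = \<beta>"
    using boundary_ren_closed[of \<Sigma> D 0 "babs As \<beta>" f] by (simp add: map_babs babs_eq_iff)
  then show "j < length As \<Longrightarrow> ren f (As ! j) = As ! j" and "map_bthesis (ren f) \<beta> = \<beta>"
    by (metis nth_map, simp)
qed

lemma raw_bthesis_of_fill: "raw_jthesis \<Sigma> D V k (fill \<beta> e) \<Longrightarrow> raw_bthesis \<Sigma> D V k \<beta>"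
  by (cases \<beta>) auto

text \<open>Stated for renamings because the abstraction rules fix a fresh variable that may already
  occur in \<Gamma>'. The induction therefore varies \<open>f\<close> and \<Gamma>' and chooses
  another fresh variable there.\<close>

lemma weakening:
  assumes T: "\<And>R. R \<in> T \<Longrightarrow> raw_rule \<Sigma> R"
  shows "jder \<Sigma> T \<Theta> \<Gamma> J \<Longrightarrow> raw_ctxs \<Sigma> \<Theta> \<Gamma>' \<Longrightarrow> ren_vctx f \<Gamma> \<Gamma>' \<Longrightarrow>
      jder \<Sigma> T \<Theta> \<Gamma>' (map_judgement (ren f) J)"
    and "bder \<Sigma> T \<Theta> \<Gamma> B \<Longrightarrow> raw_ctxs \<Sigma> \<Theta> \<Gamma>' \<Longrightarrow> ren_vctx f \<Gamma> \<Gamma>' \<Longrightarrow>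
      bder \<Sigma> T \<Theta> \<Gamma>' (map_boundary (ren f) B)"
proof (induct arbitrary: \<Gamma>' f and \<Gamma>' f rule: jder_bder.inducts)
  case (var \<Theta> \<Gamma> a A)
  then show ?case by (auto simp: ren_vctx_def intro: jder_bder.var)
next
  case (meta \<Theta> M As \<beta> ts \<Gamma>)
  note ren = ren_meta_boundary[OF meta.prems(1) meta.hyps(1), where f = f]
  have "jder \<Sigma> T \<Theta> \<Gamma>'
      (JThesis (fill (map_bthesis (esubst (vec (map (ren f) ts))) \<beta>) (Meta M (map (ren f) ts))))"
    using meta.hyps(2) meta.hyps(4)[OF _ meta.prems] meta.hyps(6)[OF meta.prems]
    by (intro jder_bder.meta[OF meta.hyps(1)])
      (auto simp: ren_esubst ren_vec ren ren_map_bthesis take_map)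
  then show ?case
    by (simp add: map_fill ren_map_bthesis ren_vec ren)
next
  case (meta_congr \<Theta> \<Gamma> M As \<beta> ss ts)
  note ren = ren_meta_boundary[OF meta_congr.prems(1) meta_congr.hyps(2), where f = f]
  have C: "ren f C = C" if "\<beta> = TermB C" for C
    using ren(2) that by simp
  have "jder \<Sigma> T \<Theta> \<Gamma>' (JThesis (fill_eq (map_bthesis (esubst (vec (map (ren f) ss))) \<beta>)
      (Meta M (map (ren f) ss)) (Meta M (map (ren f) ts))))"
    using meta_congr.hyps(4,5) meta_congr.hyps(7,9,11,13)[OF _ meta_congr.prems]
    by (intro jder_bder.meta_congr[OF meta_congr.prems(1) meta_congr.hyps(2,3)])
      (auto simp: ren_esubst ren_vec ren C ren_map_bthesis take_map)
  then show ?case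
    using meta_congr.hyps(3) by (simp add: map_fill_eq ren_map_bthesis ren_vec ren)
next
  case (abstr \<Theta> \<Gamma> A a J)
  have A: "raw_type \<Sigma> (mvar_ar \<Theta>) (cdom \<Gamma>) 0 A" and J: "raw_judgement \<Sigma> (mvar_ar \<Theta>) (cdom \<Gamma>) (Suc 0) J"
    using abstr.hyps(4) by simp_all
  obtain b where b: "b \<notin> cdom \<Gamma>'" "raw_ctxs \<Sigma> \<Theta> (\<Gamma>' @ [(b, ren f A)])"
    "ren_vctx (f(a := b)) (\<Gamma> @ [(a, A)]) (\<Gamma>' @ [(b, ren f A)])"
    using ren_vctx_snoc[OF der_raw_ctxs(1)[OF abstr.hyps(1)] abstr.prems abstr.hyps(3) A] .
  \<comment> \<open>\<open>J\<close> mentions only variables of \<Gamma>, so altering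
    \<open>f\<close> at \<open>a\<close> affects just the variable substituted for the bound
    one.\<close>
  have "map_judgement (ren (f(a := b))) J = map_judgement (ren f) J"
    using J by (rule judgement_ren_cong_raw[rotated]) (use abstr.hyps(3) in auto)
  then have body: "jder \<Sigma> T \<Theta> (\<Gamma>' @ [(b, ren f A)]) (jsubst (vec [FVar b]) (map_judgement (ren f) J))"
    using abstr.hyps(6)[OF b(2,3)] by (simp add: ren_jsubst ren_vec fun_upd_same del: fun_upd_apply)
  have "raw_judgement \<Sigma> (mvar_ar \<Theta>) (cdom \<Gamma>') 0 (map_judgement (ren f) (JAbs A J))"
    by (rule raw_judgement_ren[OF ren_vctx_cdom[OF abstr.prems(2)] abstr.hyps(4)])
  then show ?case
    using jder_bder.abstr[OF _ b(1) _ body] abstr.hyps(2)[OF abstr.prems] by simp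
next
  case (specific \<Xi> \<beta> e \<Theta> \<Gamma> I)
  have \<Xi>: "raw_mctx \<Sigma> \<Xi>" and j: "raw_jthesis \<Sigma> (mvar_ar \<Xi>) {} 0 (fill \<beta> e)"
    using T[OF specific.hyps(1)] by (auto simp: raw_rule_def)
  note I = specific.hyps(3)
  \<comment> \<open>A rule has no free variables, so renaming an instance of it means renaming the
    arguments of the instantiation.\<close>
  have "jder \<Sigma> T \<Theta> \<Gamma>' (JThesis (map_jthesis (inst (ren_inst f I)) (fill \<beta> e)))"
  proof (rule jder_bder.specific[OF specific.hyps(1) specific.prems(1)])
    show "raw_inst \<Sigma> \<Theta> \<Gamma>' \<Xi> (ren_inst f I)"
      using raw_inst_ren[OF I ren_vctx_cdom[OF specific.prems(2)]] .
    show "bder \<Sigma> T \<Theta> \<Gamma>' (BThesis (map_bthesis (inst (ren_inst f I)) \<beta>))"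
      using specific.hyps(7)[OF specific.prems] ren_inst_bthesis[OF I raw_bthesis_of_fill[OF j]]
      by simp
  qed (use specific.hyps(5)[OF _ specific.prems] ren_premise[OF I \<Xi>] in auto)
  then show ?case
    by (simp add: ren_inst_jthesis[OF I j])
next
  case (congr \<Xi> \<beta> e \<Theta> \<Gamma> I J)
  have \<Xi>: "raw_mctx \<Sigma> \<Xi>" and j: "raw_jthesis \<Sigma> (mvar_ar \<Xi>) {} 0 (fill \<beta> e)"
    using T[OF congr.hyps(1)] by (auto simp: raw_rule_def)
  note I = congr.hyps(4) and J = congr.hyps(5)
  \<comment> \<open>Since \<beta> is an object boundary, its filling contains the head
    \<open>e\<close>, so rawness of the rule makes \<open>e\<close> raw.\<close>
  have e: "ren f (inst I e) = inst (ren_inst f I) e" "ren f (inst J e) = inst (ren_inst f J) e"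
    using congr.hyps(2) j by (cases \<beta>; auto simp: object_cls_def ren_of_inst[OF I] ren_of_inst[OF J])+
  have "jder \<Sigma> T \<Theta> \<Gamma>' (JThesis (fill_eq (map_bthesis (inst (ren_inst f I)) \<beta>)
      (inst (ren_inst f I) e) (inst (ren_inst f J) e)))"
  proof (rule jder_bder.congr[OF congr.hyps(1,2) congr.prems(1)])
    show "raw_inst \<Sigma> \<Theta> \<Gamma>' \<Xi> (ren_inst f I)" "raw_inst \<Sigma> \<Theta> \<Gamma>' \<Xi> (ren_inst f J)"
      using raw_inst_ren[OF _ ren_vctx_cdom[OF congr.prems(2)]] I J by blast+
    show "jder \<Sigma> T \<Theta> \<Gamma>' (JThesis (TypeEq (inst (ren_inst f I) B) (inst (ren_inst f J) B)))"
      if B: "\<beta> = TermB B" for B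
      using congr.hyps(13)[OF B congr.prems] j B by (auto simp: ren_of_inst[OF I] ren_of_inst[OF J])
  qed (use congr.hyps(7,9)[OF _ congr.prems] congr.hyps(11)[OF _ _ congr.prems]
      ren_premise[OF I \<Xi>] ren_premise[OF J \<Xi>] ren_premise_eq[OF I J \<Xi>] in auto)
  then show ?case
    using congr.hyps(2) by (simp add: map_fill_eq e ren_inst_bthesis[OF I raw_bthesis_of_fill[OF j]])
next
  case (bdry_abstr \<Theta> \<Gamma> A a B)
  have A: "raw_type \<Sigma> (mvar_ar \<Theta>) (cdom \<Gamma>) 0 A" and B: "raw_boundary \<Sigma> (mvar_ar \<Theta>) (cdom \<Gamma>) (Suc 0) B"
    using bdry_abstr.hyps(4) by simp_all
  obtain b where b: "b \<notin> cdom \<Gamma>'" "raw_ctxs \<Sigma> \<Theta> (\<Gamma>' @ [(b, ren f A)])"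
    "ren_vctx (f(a := b)) (\<Gamma> @ [(a, A)]) (\<Gamma>' @ [(b, ren f A)])"
    using ren_vctx_snoc[OF der_raw_ctxs(1)[OF bdry_abstr.hyps(1)] bdry_abstr.prems bdry_abstr.hyps(3) A] .
  have "map_boundary (ren (f(a := b))) B = map_boundary (ren f) B"
    using B by (rule boundary_ren_cong_raw[rotated]) (use bdry_abstr.hyps(3) in auto)
  then have body: "bder \<Sigma> T \<Theta> (\<Gamma>' @ [(b, ren f A)]) (bsubst (vec [FVar b]) (map_boundary (ren f) B))"
    using bdry_abstr.hyps(6)[OF b(2,3)] by (simp add: ren_bsubst ren_vec fun_upd_same del: fun_upd_apply)
  have "raw_boundary \<Sigma> (mvar_ar \<Theta>) (cdom \<Gamma>') 0 (map_boundary (ren f) (BAbs A B))"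
    by (rule raw_boundary_ren[OF ren_vctx_cdom[OF bdry_abstr.prems(2)] bdry_abstr.hyps(4)])
  then show ?case
    using jder_bder.bdry_abstr[OF _ b(1) _ body] bdry_abstr.hyps(2)[OF bdry_abstr.prems] by simp
next
  case (type_trans \<Theta> \<Gamma> A B C)
  then show ?case by simp (blast intro: jder_bder.type_trans)
next
  case (term_trans \<Theta> \<Gamma> s t A u)
  then show ?case by simp (blast intro: jder_bder.term_trans)
next
  case (conv \<Theta> \<Gamma> t A B)
  then show ?case by simp (blast intro: jder_bder.conv)
next
  case (conv_eq \<Theta> \<Gamma> s t A B)
  then show ?case by simp (blast intro: jder_bder.conv_eq)
qed (auto intro: type_refl type_sym term_refl term_sym bdry_type bdry_term bdry_type_eq bdry_term_eq)

text \<open>The type was formed over a prefix of \<Gamma>, and the identity renames this prefix into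
  \<Gamma>.\<close>

lemma wf_vctx_lookup:
  assumes T: "\<And>R. R \<in> T \<Longrightarrow> raw_rule \<Sigma> R"
    and "wf_vctx \<Sigma> T \<Theta> \<Gamma>" "raw_ctxs \<Sigma> \<Theta> \<Gamma>" "map_of \<Gamma> a = Some A"
  shows "jder \<Sigma> T \<Theta> \<Gamma> (JThesis (IsType A))"
proof -
  \<comment> \<open>An inclusion of lookup maps stands in for being a prefix; this is the form that
    weakening consumes.\<close>
  have "\<exists>\<Gamma>\<^sub>0. jder \<Sigma> T \<Theta> \<Gamma>\<^sub>0 (JThesis (IsType A)) \<and> map_of \<Gamma>\<^sub>0 \<subseteq>\<^sub>m map_of \<Gamma>"
    using assms(2,4)
  proof (induction rule: wf_vctx.induct)
    case (2 \<Gamma> C c)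
    have *: "map_of \<Gamma> \<subseteq>\<^sub>m map_of (\<Gamma> @ [(c, C)])"
      by (auto simp: map_le_def map_add_def)
    show ?case
    proof (cases "map_of \<Gamma> a")
      case None
      then show ?thesis using 2 * by (auto simp: map_add_def split: if_splits)
    next
      case (Some A')
      then have "map_of \<Gamma> a = Some A" using 2 by (simp add: map_add_def)
      then show ?thesis using 2 * map_le_trans by blast
    qed
  qed simp
  then obtain \<Gamma>\<^sub>0 where \<Gamma>\<^sub>0: "jder \<Sigma> T \<Theta> \<Gamma>\<^sub>0 (JThesis (IsType A))" "map_of \<Gamma>\<^sub>0 \<subseteq>\<^sub>m map_of \<Gamma>"
    by blast
  then have "ren_vctx (\<lambda>a. a) \<Gamma>\<^sub>0 \<Gamma>"
    by (auto simp: ren_vctx_def ren_id map_le_def dom_def)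
  from weakening(1)[OF T \<Gamma>\<^sub>0(1) assms(3) this] show ?thesis
    by (simp add: ren_id)
qed

section \<open>Presuppositions\<close>

inductive_cases bder_TermB: "bder \<Sigma> T \<Theta> \<Gamma> (BThesis (TermB A))"
inductive_cases bder_TypeEqB: "bder \<Sigma> T \<Theta> \<Gamma> (BThesis (TypeEqB A B))"
inductive_cases bder_TermEqB: "bder \<Sigma> T \<Theta> \<Gamma> (BThesis (TermEqB s t A))"

text \<open>A left inverse of filling. Derivability of this boundary bundles the presuppositions of
  all four thesis forms into one statement.\<close>

fun jboundary :: "'e jthesis \<Rightarrow> 'e bthesis" where
  "jboundary (IsType A) = TypeB"
| "jboundary (HasType t A) = TermB A"
| "jboundary (TypeEq A B) = TypeEqB A B"
| "jboundary (TermEq s t A) = TermEqB s t A"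

lemma jboundary_fill [simp]: "jboundary (fill \<beta> e) = \<beta>"
  by (cases \<beta>) auto

text \<open>
  Both congruence rules carry the two typings and the equation of the types as premises, so the
  induction needs neither substitution lemmas nor the presuppositions of abstracted judgements.
\<close>

lemma presuppositions:
  assumes T: "\<And>R. R \<in> T \<Longrightarrow> raw_rule \<Sigma> R"
  shows "jder \<Sigma> T \<Theta> \<Gamma> J \<Longrightarrow> wf_vctx \<Sigma> T \<Theta> \<Gamma> \<Longrightarrow> J = JThesis j \<Longrightarrow>
      bder \<Sigma> T \<Theta> \<Gamma> (BThesis (jboundary j))"
    and "bder \<Sigma> T \<Theta> \<Gamma> B \<Longrightarrow> True"
proof (induct arbitrary: j rule: jder_bder.inducts)
  case (var \<Theta> \<Gamma> a A)
  then show ?case by (auto intro!: bdry_term wf_vctx_lookup[OF T])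
next
  case (meta_congr \<Theta> \<Gamma> M As \<beta> ss ts)
  show ?case
  proof (cases \<beta>)
    case TypeB
    have "jder \<Sigma> T \<Theta> \<Gamma> (JThesis (IsType (Meta M us)))"
      if "length us = length As"
        "\<And>j. j < length As \<Longrightarrow> jder \<Sigma> T \<Theta> \<Gamma> (JThesis (HasType (us ! j) (esubst (vec (take j us)) (As ! j))))"
      for us
      using jder_bder.meta[OF meta_congr.hyps(2) that] TypeB bdry_type[OF meta_congr.hyps(1)] by simp
    then show ?thesis
      using meta_congr.hyps(4,5,6,8) meta_congr.prems(2) TypeB by (auto intro!: bdry_type_eq)
  next
    case (TermB C)
    have eq: "jder \<Sigma> T \<Theta> \<Gamma> (JThesis (TypeEq (esubst (vec ss) C) (esubst (vec ts) C)))"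
      using meta_congr.hyps(12)[OF TermB] .
    \<comment> \<open>Both instances of \<open>C\<close> are types by the induction hypothesis for
      the equation between them.\<close>
    have C: "jder \<Sigma> T \<Theta> \<Gamma> (JThesis (IsType (esubst (vec ss) C)))"
      "jder \<Sigma> T \<Theta> \<Gamma> (JThesis (IsType (esubst (vec ts) C)))"
      using meta_congr.hyps(13)[OF TermB meta_congr.prems(1) refl] by (auto elim: bder_TypeEqB)
    have "jder \<Sigma> T \<Theta> \<Gamma> (JThesis (HasType (Meta M ss) (esubst (vec ss) C)))"
      using jder_bder.meta[OF meta_congr.hyps(2,4,6)] TermB C(1) by (simp add: bdry_term)
    \<comment> \<open>The right side is typed by the instance of \<open>C\<close> at
      \<open>ts\<close>, but the equation lives at the one at \<open>ss\<close>; the reversed type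
      equation converts it.\<close>
    moreover have "jder \<Sigma> T \<Theta> \<Gamma> (JThesis (HasType (Meta M ts) (esubst (vec ts) C)))"
      using jder_bder.meta[OF meta_congr.hyps(2,5,8)] TermB C(2) by (simp add: bdry_term)
    ultimately show ?thesis
      using meta_congr.prems(2) TermB C(1) conv[OF _ type_sym[OF eq]] by (auto intro!: bdry_term_eq)
  qed (use meta_congr.hyps(3) in \<open>simp_all add: object_cls_def\<close>)
next
  case (congr \<Xi> \<beta> e \<Theta> \<Gamma> I J)
  show ?case
  proof (cases \<beta>)
    case TypeB
    have "jder \<Sigma> T \<Theta> \<Gamma> (JThesis (IsType (inst I e)))" "jder \<Sigma> T \<Theta> \<Gamma> (JThesis (IsType (inst J e)))"
      using jder_bder.specific[OF congr.hyps(1,3,4,6)] jder_bder.specific[OF congr.hyps(1,3,5,8)]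
        TypeB bdry_type[OF congr.hyps(3)] by simp_all
    then show ?thesis
      using congr.prems(2) TypeB by (auto intro: bdry_type_eq)
  next
    case (TermB C)
    have eq: "jder \<Sigma> T \<Theta> \<Gamma> (JThesis (TypeEq (inst I C) (inst J C)))"
      using congr.hyps(12)[OF TermB] .
    have C: "jder \<Sigma> T \<Theta> \<Gamma> (JThesis (IsType (inst I C)))" "jder \<Sigma> T \<Theta> \<Gamma> (JThesis (IsType (inst J C)))"
      using congr.hyps(13)[OF TermB congr.prems(1) refl] by (auto elim: bder_TypeEqB)
    have "jder \<Sigma> T \<Theta> \<Gamma> (JThesis (HasType (inst I e) (inst I C)))"
      "jder \<Sigma> T \<Theta> \<Gamma> (JThesis (HasType (inst J e) (inst J C)))"
      using jder_bder.specific[OF congr.hyps(1,3,4,6)] jder_bder.specific[OF congr.hyps(1,3,5,8)]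
        TermB C by (simp_all add: bdry_term)
    then show ?thesis
      using congr.prems(2) TermB C(1) conv[OF _ type_sym[OF eq]] by (auto intro!: bdry_term_eq)
  qed (use congr.hyps(2) in \<open>simp_all add: object_cls_def\<close>)
next
  case (type_trans \<Theta> \<Gamma> A B C)
  then show ?case by (auto intro!: bdry_type_eq elim!: bder_TypeEqB)
next
  case (conv \<Theta> \<Gamma> t A B)
  then show ?case by (auto intro: bdry_term elim!: bder_TypeEqB)
next
  case (conv_eq \<Theta> \<Gamma> s t A B)
  then show ?case by (auto intro!: bdry_term_eq intro: jder_bder.conv elim!: bder_TypeEqB bder_TermEqB)
qed (auto simp: map_fill intro!: bdry_type_eq bdry_term_eq
    elim: bder_TermB bder_TypeEqB bder_TermEqB dest: der_raw_ctxs)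

section \<open>Natural types\<close>

lemma raw_arg_esubst_id:
  "raw_arg \<Sigma> D V k \<alpha> e \<Longrightarrow> (\<And>i. i < k \<Longrightarrow> \<sigma> i = BVar i) \<Longrightarrow> esubst \<sigma> e = e"
proof (induction arbitrary: \<sigma> rule: raw_arg.induct)
  case (raw_Sym S c ars k es)
  then show ?case by (fastforce simp: list_all2_conv_all_nth in_set_conv_nth intro!: map_idI)
next
  case (raw_Meta M c ts k)
  then show ?case by (auto simp: list_all_iff intro!: map_idI)
next
  case (raw_Abs k c n e)
  show ?case
    using raw_Abs.IH[of "up \<sigma>"] raw_Abs.prems by (simp add: up_def split: nat.split)
qed auto

text \<open>The arity guarantees \<open>n\<close> outer abstractions, so stripping them loses
  nothing and releases \<open>n\<close> further bound variables.\<close>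

lemma Abs_unabs:
  "raw_arg \<Sigma> D V k (c, n) e \<Longrightarrow>
    (Abs ^^ n) (unabs n e) = e \<and> raw_arg \<Sigma> D V (k + n) (c, 0) (unabs n e)"
  by (induction n arbitrary: k e) (fastforce elim!: raw_arg_SucE)+

lemma inst_Abs: "inst I ((Abs ^^ n) e) = (Abs ^^ n) (inst I e)"
  by (induction n) auto

text \<open>The generic argument applies \<open>M\<close> to its own bound variables. Instantiating
  it is an eta-expansion, which gives back \<open>e\<close> because \<open>e\<close> has as many
  abstractions as its arity says.\<close>

lemma inst_generic:
  assumes "raw_arg \<Sigma> D V 0 (ar B) e" "map_of I M = Some e"
  shows "inst I (generic (M, B)) = e"
proof -
  obtain c n where cn: "ar B = (c, n)" by fastforce
  have e: "(Abs ^^ n) (unabs n e) = e" "raw_arg \<Sigma> D V n (c, 0) (unabs n e)"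
    using Abs_unabs[of \<Sigma> D V 0 c n e] assms(1) cn by auto
  show ?thesis
  proof (cases "object_cls c")
    case True
    \<comment> \<open>\<open>vec\<close> reads its list from the end and the list is descending, so
      index \<open>i < n\<close> is sent to itself.\<close>
    have "esubst (vec (map BVar (rev [0..<n]))) (unabs n e) = unabs n e"
      using e(2) by (rule raw_arg_esubst_id) (auto simp: vec_def rev_nth)
    then show ?thesis
      using True assms(2) e(1) by (simp add: generic_def cn inst_Abs comp_def)
  next
    case False
    \<comment> \<open>The dummy is the only raw expression of an equality class.\<close>
    then have "unabs n e = Star"
      using e(2) by (auto elim: raw_arg.cases simp: object_cls_def)
    then show ?thesis
      using False e(1) by (auto simp: generic_def cn inst_Abs)
  qed
qed

lemma raw_inst_generic:
  assumes I: "raw_inst \<Sigma> \<Theta> \<Gamma> \<Xi> I" and \<Xi>: "raw_mctx \<Sigma> \<Xi>"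
  shows "map (inst I) (map generic \<Xi>) = map snd I"
proof (rule nth_equalityI)
  show "length (map (inst I) (map generic \<Xi>)) = length (map snd I)"
    using raw_inst_length[OF I] by simp
next
  fix i assume "i < length (map (inst I) (map generic \<Xi>))"
  then have i: "i < length \<Xi>" by simp
  obtain M B where MB: "\<Xi> ! i = (M, B)" by fastforce
  have fst: "map fst I = map fst \<Xi>" using I by (simp add: raw_inst_def)
  then have "fst (I ! i) = M"
    using i MB raw_inst_length[OF I] by (metis fst_conv nth_map)
  then have "I ! i = (M, snd (I ! i))" by (metis prod.collapse)
  \<comment> \<open>The metavariables are distinct, so lookup finds the entry at position
    \<open>i\<close>.\<close>
  then have "map_of I M = Some (snd (I ! i))"
    using \<Xi> i fst raw_inst_length[OF I]
    by (metis map_of_is_SomeI nth_mem raw_mctx_def)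
  moreover have "raw_arg \<Sigma> (mvar_ar \<Theta>) (cdom \<Gamma>) 0 (ar B) (snd (I ! i))"
    using I i MB by (auto simp: raw_inst_def)
  ultimately show "map (inst I) (map generic \<Xi>) ! i = map snd I ! i"
    using i MB inst_generic raw_inst_length[OF I] by fastforce
qed

text \<open>The context \<Xi> fixes the keys, and the instantiated generic arguments are the
  values.\<close>

lemma raw_inst_eqI:
  assumes "raw_inst \<Sigma> \<Theta> \<Gamma> \<Xi> I" "raw_inst \<Sigma> \<Theta> \<Gamma> \<Xi> J" "raw_mctx \<Sigma> \<Xi>"
    and "map (inst I) (map generic \<Xi>) = map (inst J) (map generic \<Xi>)"
  shows "I = J"
proof -
  have "map snd I = map snd J" "map fst I = map fst J"
    using assms(1,2,4) raw_inst_generic[OF assms(1,3)] raw_inst_generic[OF assms(2,3)]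
    by (simp_all add: raw_inst_def del: map_map map_eq_conv)
  then show ?thesis by (metis zip_map_fst_snd)
qed

text \<open>A relation, since a symbol term does not carry its rule and instantiation; in a standard
  theory they are determined, as shown below. Derivability of the type is deliberately not part of
  it.\<close>

inductive natural_type ::
    "'s signature \<Rightarrow> 's rule set \<Rightarrow> 's mctx \<Rightarrow> 's vctx \<Rightarrow> 's expr \<Rightarrow> 's expr \<Rightarrow> bool"
  for \<Sigma> T \<Theta> \<Gamma> where
  natural_FVar: "map_of \<Gamma> a = Some A \<Longrightarrow> natural_type \<Sigma> T \<Theta> \<Gamma> (FVar a) A"
| natural_Meta: "map_of \<Theta> M = Some (babs As (TermB C)) \<Longrightarrow>
    natural_type \<Sigma> T \<Theta> \<Gamma> (Meta M ts) (esubst (vec ts) C)"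
| natural_Sym: "(\<Xi>, HasType (Sym S (map generic \<Xi>)) B) \<in> T \<Longrightarrow>
    symbol_rule \<Sigma> S (\<Xi>, HasType (Sym S (map generic \<Xi>)) B) \<Longrightarrow> raw_inst \<Sigma> \<Theta> \<Gamma> \<Xi> I \<Longrightarrow>
    natural_type \<Sigma> T \<Theta> \<Gamma> (Sym S (map (inst I) (map generic \<Xi>))) (inst I B)"

inductive_cases natural_FVarE: "natural_type \<Sigma> T \<Theta> \<Gamma> (FVar a) A"
inductive_cases natural_MetaE: "natural_type \<Sigma> T \<Theta> \<Gamma> (Meta M ts) A"

section \<open>Symbol rules of a standard theory and uniqueness of natural types\<close>

lemma standard_theory_raw_rule:
  "standard_theory \<Sigma> I R \<Longrightarrow> Q \<in> R ` I \<Longrightarrow> raw_rule \<Sigma> Q"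
  by (auto simp: standard_theory_def finitary_theory_def raw_theory_def)

lemma standard_theory_term_rule:
  assumes "standard_theory \<Sigma> I R" "(\<Xi>, HasType e B) \<in> R ` I"
  obtains S where "e = Sym S (map generic \<Xi>)" "symbol_rule \<Sigma> S (\<Xi>, HasType e B)"
proof -
  have "object_rule (\<Xi>, HasType e B)"
    unfolding object_rule_def
    by (intro exI[of _ \<Xi>] exI[of _ "TermB B"] exI[of _ e]) (simp add: object_cls_def)
  then obtain S where S: "symbol_rule \<Sigma> S (\<Xi>, HasType e B)"
    using assms by (auto simp: standard_theory_def)
  \<comment> \<open>The filling is a term judgement, so \<beta> is a term boundary and the heads on
    both sides agree.\<close>
  then obtain \<beta> where "HasType e B = fill \<beta> (Sym S (map generic \<Xi>))"
    by (auto simp: symbol_rule_def)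
  then have "e = Sym S (map generic \<Xi>)" by (cases \<beta>) auto
  with S show ?thesis using that by blast
qed

text \<open>Standardness makes the index of the rule for \<open>S\<close> unique, hence also the
  rule at that index.\<close>

lemma standard_theory_symbol_rule_unique:
  assumes "standard_theory \<Sigma> I R" "Q \<in> R ` I" "Q' \<in> R ` I"
    and "symbol_rule \<Sigma> S Q" "symbol_rule \<Sigma> S Q'"
  shows "Q = Q'"
proof -
  have "S \<in> dom \<Sigma>" using assms(4) by (auto simp: symbol_rule_def)
  then show ?thesis using assms by (auto simp: standard_theory_def)
qed

lemma natural_type_unique:
  assumes std: "standard_theory \<Sigma> I R"
    and "natural_type \<Sigma> (R ` I) \<Theta> \<Gamma> t A" "natural_type \<Sigma> (R ` I) \<Theta> \<Gamma> t B"
  shows "A = B"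
  using assms(2,3)
proof (cases rule: natural_type.cases)
  case (natural_FVar a)
  then show ?thesis using assms(3) by (auto elim: natural_FVarE)
next
  case (natural_Meta M As C ts)
  then show ?thesis using assms(3) by (auto simp: babs_eq_iff elim!: natural_MetaE)
next
  case (natural_Sym \<Xi> S C K)
  note K = this
  from assms(3) show ?thesis
  proof (cases rule: natural_type.cases)
    case (natural_Sym \<Xi>' S' C' K')
    have eq: "S' = S" "map (inst K) (map generic \<Xi>) = map (inst K') (map generic \<Xi>')"
      using K(1) natural_Sym(1) by (simp_all del: map_map)
    \<comment> \<open>Equal symbols force equal rules; only then do the equal argument lists compare
      instantiations of one context.\<close>
    have same: "\<Xi>' = \<Xi>" "C' = C"
      using standard_theory_symbol_rule_unique[OF std K(3) natural_Sym(3) K(4)] natural_Sym(4) eq(1)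
      by auto
    have "raw_mctx \<Sigma> \<Xi>"
      using standard_theory_raw_rule[OF std K(3)] by (simp add: raw_rule_def)
    then have "K = K'"
      using raw_inst_eqI[OF K(5) natural_Sym(5)[unfolded same(1)]] eq(2)[unfolded same(1)] by blast
    then show ?thesis using K(2) natural_Sym(2) same(2) by simp
  qed (use K(1) in simp_all)
qed

text \<open>The disjunction accounts for variables: their declared type need not be derivable, so
  literal equality replaces reflexivity. For metavariables and symbols the boundary premise provides
  the type and hence reflexivity.\<close>

lemma natural_type_exists:
  assumes std: "standard_theory \<Sigma> I R"
  shows "jder \<Sigma> T \<Theta> \<Gamma> J \<Longrightarrow> T = R ` I \<Longrightarrow> J = JThesis (HasType t A) \<Longrightarrow>
      \<exists>A\<^sub>0. natural_type \<Sigma> T \<Theta> \<Gamma> t A\<^sub>0 \<and>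
        (t \<in> range FVar \<and> A = A\<^sub>0 \<or> jder \<Sigma> T \<Theta> \<Gamma> (JThesis (TypeEq A\<^sub>0 A)))"
    and "bder \<Sigma> T \<Theta> \<Gamma> B \<Longrightarrow> True"
proof (induct arbitrary: t A rule: jder_bder.inducts)
  case (var \<Theta> \<Gamma> a B)
  then show ?case by (auto intro: natural_FVar)
next
  case (meta \<Theta> M As \<beta> ts \<Gamma>)
  then obtain C where C: "\<beta> = TermB C" "t = Meta M ts" "A = esubst (vec ts) C"
    by (cases \<beta>) auto
  then have "jder \<Sigma> T \<Theta> \<Gamma> (JThesis (IsType A))"
    using meta.hyps(5) by (auto elim: bder_TermB)
  then show ?case
    using C meta.hyps(1) by (auto intro: natural_Meta type_refl)
next
  case (specific \<Xi> \<beta> e \<Theta> \<Gamma> K)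
  then obtain C where C: "\<beta> = TermB C" "t = inst K e" "A = inst K C"
    by (cases \<beta>) auto
  then have A: "jder \<Sigma> T \<Theta> \<Gamma> (JThesis (IsType A))"
    using specific.hyps(6) by (auto elim: bder_TermB)
  have rule: "(\<Xi>, HasType e C) \<in> R ` I"
    using specific.hyps(1) specific.prems(1) C by simp
  obtain S where "e = Sym S (map generic \<Xi>)" "symbol_rule \<Sigma> S (\<Xi>, HasType e C)"
    using standard_theory_term_rule[OF std rule] .
  then have "natural_type \<Sigma> T \<Theta> \<Gamma> t A"
    using natural_Sym[of \<Xi> S C T \<Sigma> \<Theta> \<Gamma> K] rule specific.hyps(3) specific.prems(1) C by simp
  then show ?case using A type_refl by blast
next
  case (conv \<Theta> \<Gamma> s A' B)
  then obtain A\<^sub>0 where "natural_type \<Sigma> T \<Theta> \<Gamma> t A\<^sub>0"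
    "A' = A\<^sub>0 \<or> jder \<Sigma> T \<Theta> \<Gamma> (JThesis (TypeEq A\<^sub>0 A'))"
    by blast
  \<comment> \<open>If \<open>A'\<close> is itself the natural type, the conversion equation is
    already the required one; otherwise transitivity applies.\<close>
  then show ?case using conv.hyps(3) conv.prems(2) type_trans by blast
next
  case (meta_congr \<Theta> \<Gamma> M As \<beta> ss ts)
  \<comment> \<open>Filling an object boundary with an equation never yields a typing judgement, so
    the case is vacuous.\<close>
  then show ?case by (cases \<beta>) (auto simp: object_cls_def)
next
  case (congr \<Xi> \<beta> e \<Theta> \<Gamma> I J)
  then show ?case by (cases \<beta>) (auto simp: object_cls_def)
qed simp_all

text \<open>Well-formedness of \<Gamma> is assumed just where reflexivity at the type of a variable
  must be proved.\<close>

lemma uniqueness_of_typing: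
  assumes std: "standard_theory \<Sigma> I R"
    and wf: "t \<in> range FVar \<and> A = B \<longrightarrow> wf_vctx \<Sigma> (R ` I) \<Theta> \<Gamma>"
    and t: "jder \<Sigma> (R ` I) \<Theta> \<Gamma> (JThesis (HasType t A))" "jder \<Sigma> (R ` I) \<Theta> \<Gamma> (JThesis (HasType t B))"
  shows "jder \<Sigma> (R ` I) \<Theta> \<Gamma> (JThesis (TypeEq A B))"
proof -
  obtain A\<^sub>0 where A\<^sub>0: "natural_type \<Sigma> (R ` I) \<Theta> \<Gamma> t A\<^sub>0"
    "t \<in> range FVar \<and> A = A\<^sub>0 \<or> jder \<Sigma> (R ` I) \<Theta> \<Gamma> (JThesis (TypeEq A\<^sub>0 A))"
    using natural_type_exists(1)[OF std t(1) refl refl] by blast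
  obtain B\<^sub>0 where B\<^sub>0: "natural_type \<Sigma> (R ` I) \<Theta> \<Gamma> t B\<^sub>0"
    "t \<in> range FVar \<and> B = B\<^sub>0 \<or> jder \<Sigma> (R ` I) \<Theta> \<Gamma> (JThesis (TypeEq B\<^sub>0 B))"
    using natural_type_exists(1)[OF std t(2) refl refl] by blast
  have "A\<^sub>0 = B\<^sub>0"
    using natural_type_unique[OF std A\<^sub>0(1) B\<^sub>0(1)] .
  show ?thesis
  proof (cases "t \<in> range FVar \<and> A = B")
    case True
    then have "bder \<Sigma> (R ` I) \<Theta> \<Gamma> (BThesis (TermB A))"
      using presuppositions(1)[OF standard_theory_raw_rule[OF std] t(1)] wf by simp
    then show ?thesis using True by (auto intro: type_refl elim: bder_TermB)
  next
    case False
    \<comment> \<open>If \<open>t\<close> is a variable, then \<open>A\<close> and \<open>B\<close>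
      differ, so at most one of them is the common natural type and at least one equation with it is
      available. Otherwise both equations are.\<close>
    then show ?thesis
      using A\<^sub>0(2) B\<^sub>0(2) \<open>A\<^sub>0 = B\<^sub>0\<close> by (auto intro: type_sym type_trans)
  qed
qed

theorem mainTheorem8:
  fixes \<Sigma> :: "'s signature" and I :: "'i set" and R :: "'i \<Rightarrow> 's rule"
  assumes "standard_theory \<Sigma> I R"
  shows "(\<forall>\<Theta> \<Gamma> t A B.
            (t \<in> range FVar \<and> A = B \<longrightarrow> wf_vctx \<Sigma> (R ` I) \<Theta> \<Gamma>) \<longrightarrow>
            jder \<Sigma> (R ` I) \<Theta> \<Gamma> (JThesis (HasType t A)) \<longrightarrow>
            jder \<Sigma> (R ` I) \<Theta> \<Gamma> (JThesis (HasType t B)) \<longrightarrow>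
            jder \<Sigma> (R ` I) \<Theta> \<Gamma> (JThesis (TypeEq A B))) \<and>
         (\<forall>\<Theta> \<Gamma> s t A B.
            wf_mctx \<Sigma> (R ` I) \<Theta> \<longrightarrow> wf_vctx \<Sigma> (R ` I) \<Theta> \<Gamma> \<longrightarrow>
            jder \<Sigma> (R ` I) \<Theta> \<Gamma> (JThesis (TermEq s t A)) \<longrightarrow>
            jder \<Sigma> (R ` I) \<Theta> \<Gamma> (JThesis (TermEq s t B)) \<longrightarrow>
            jder \<Sigma> (R ` I) \<Theta> \<Gamma> (JThesis (TypeEq A B)))"
proof -
  \<comment> \<open>By presupposition the left side \<open>s\<close> of an equation has its type, so
    two equations with the same sides give two typings of \<open>s\<close>.\<close>
  have left: "jder \<Sigma> (R ` I) \<Theta> \<Gamma> (JThesis (HasType s A))"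
    if "wf_vctx \<Sigma> (R ` I) \<Theta> \<Gamma>" "jder \<Sigma> (R ` I) \<Theta> \<Gamma> (JThesis (TermEq s t A))" for \<Theta> \<Gamma> s t A
    using presuppositions(1)[OF standard_theory_raw_rule[OF assms] that(2,1) refl]
    by (auto elim: bder_TermEqB)
  show ?thesis
    using uniqueness_of_typing[OF assms] left by blast
qed

end
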